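(* Let $(\varepsilon_{\mathbf{j}})_{\mathbf{j}\in J}$ and $(r_{\mathbf{j}})_{\mathbf{j}\in J}$ be sequences in $(0,\tfrac12)$ such that (i) $\sum_{\mathbf{j}} r_{\mathbf{j}}\le 1/(2^8+1)$; (ii) $\varepsilon_{\mathbf{1}}<1/4$; (iii) $\varepsilon_{\mathbf{j}+1}\le\frac{3}{10}\varepsilon_{\mathbf{j}}$ for all $\mathbf{j}\in J$; (iv) $r_{\mathbf{j}}\le 2^{-18}\varepsilon_{\mathbf{j}}^3$ for all $\mathbf{j}\in J$. Let $\Omega_{\mathbf{0}}=B_1\setminus\bigcup_{\mathbf{j}\in J}\overline{B_{\mathbf{j}}}$. Then $\partial\Omega_{\mathbf{0}}=\partial^*\Omega_{\mathbf{0}}$.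
   Context: $B_r(x)$ is the open disk in $\mathbb{R}^2$ of center $x$ and radius $r$, $B_1=B_1(0)$; $\partial$ is the topological boundary. Reduced boundary: for a set $E\subset\mathbb{R}^2$ of finite perimeter, $\partial^e E$ is the complement of the set of points of density $0$ or $1$ for $E$, and $\partial^*E$ is the set of $x\in\partial^eE$ such that $\lim_{r\to0^+}\frac{D\chi_E(B_r(x))}{|D\chi_E|(B_r(x))}$ exists and is a unit vector, where $D\chi_E$ is the distributional gradient of the characteristic function of $E$. Indices: $J$ is the set of pairs $\mathbf{j}=(j_1,j_2)$ of positive integers with $j_2\le j_1$, ordered lexicographically; its first element is $\mathbf{1}=(1,1)$; the successor is $\mathbf{j}+1=(j_1+1,1)$ if $j_2=j_1$ and $\mathbf{j}+1=(j_1,j_2+1)$ if $j_2<j_1$. Holes: for $\mathbf{j}\in J$ set $\rho_{\mathbf{j}}=1-\varepsilon_{\mathbf{j}}$, $\theta_{\mathbf{j}}=j_2\cdot\frac{\pi}{2(j_1+1)}$, $x_{\mathbf{j}}=\rho_{\mathbf{j}}(\cos\theta_{\mathbf{j}},\sin\theta_{\mathbf{j}})$, $B_{\mathbf{j}}=B_{r_{\mathbf{j}}}(x_{\mathbf{j}})$. *)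

theory Defs
  imports "HOL-Analysis.Analysis"
begin

section \<open>Vector measures\<close>

text \<open>A vector measure is encoded as its set function; the values off the Borel sets are irrelevant.
  Countable additivity includes the value 0 on the empty set.\<close>

definition vector_measure :: "('a::topological_space set \<Rightarrow> 'b::real_normed_vector) \<Rightarrow> bool" where
  "vector_measure \<mu> \<longleftrightarrow>
     (\<forall>A :: nat \<Rightarrow> 'a set. range A \<subseteq> sets borel \<and> disjoint_family A \<longrightarrow>
        (\<lambda>n. \<mu> (A n)) sums \<mu> (\<Union>n. A n))"

definition total_variation ::
    "('a::topological_space set \<Rightarrow> 'b::real_normed_vector) \<Rightarrow> 'a set \<Rightarrow> ennreal" where
  "total_variation \<mu> B =
     (SUP A \<in> {A :: nat \<Rightarrow> 'a set. range A \<subseteq> sets borel \<and> disjoint_family A \<and> (\<Union>n. A n) = B}.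
        \<Sum>n. ennreal (norm (\<mu> (A n))))"

text \<open>Integration against a finite signed Borel measure \<open>\<mu>\<close> is by writing \<open>\<mu> = P - N\<close> with
  finite positive measures, for instance the Jordan decomposition.  On bounded Borel functions, the
  only ones integrated below, the value does not depend on the choice of \<open>P\<close> and \<open>N\<close>.\<close>

definition has_signed_integral ::
    "('a::topological_space \<Rightarrow> real) \<Rightarrow> ('a set \<Rightarrow> real) \<Rightarrow> real \<Rightarrow> bool" where
  "has_signed_integral f \<mu> I \<longleftrightarrow>
     (\<exists>P N. finite_measure P \<and> finite_measure N \<and> sets P = sets borel \<and> sets N = sets borel \<and>
        (\<forall>A \<in> sets borel. \<mu> A = measure P A - measure N A) \<and>
        integrable P f \<and> integrable N f \<and> I = (LINT x|P. f x) - (LINT x|N. f x))"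

section \<open>Sets of finite perimeter\<close>

text \<open>Test functions are of class $C^1_c$, as usual for sets of finite perimeter; for gradients that
  are measures this is equivalent, by mollification, to testing with $C^\infty_c$.\<close>

definition C1_test_function :: "('a::euclidean_space \<Rightarrow> real) \<Rightarrow> bool" where
  "C1_test_function \<phi> \<longleftrightarrow>
     (\<forall>x. \<phi> differentiable (at x)) \<and>
     (\<forall>v. continuous_on UNIV (\<lambda>x. frechet_derivative \<phi> (at x) v)) \<and>
     compact (closure {x. \<phi> x \<noteq> 0})"

definition is_gradient_measure ::
    "'a::euclidean_space set \<Rightarrow> ('a set \<Rightarrow> 'a) \<Rightarrow> bool" where
  "is_gradient_measure E D \<longleftrightarrow>
     vector_measure D \<and>
     (\<forall>\<phi>. C1_test_function \<phi> \<longrightarrow>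
        (\<forall>i \<in> Basis. has_signed_integral \<phi> (\<lambda>A. D A \<bullet> i)
           (- (LINT x:E|lebesgue. frechet_derivative \<phi> (at x) i))))"

definition finite_perimeter :: "'a::euclidean_space set \<Rightarrow> bool" where
  "finite_perimeter E \<longleftrightarrow> E \<in> sets lebesgue \<and> (\<exists>D. is_gradient_measure E D)"

text \<open>The choice is immaterial: the gradient measure is uniquely determined on Borel sets.\<close>

definition gradient_measure :: "'a::euclidean_space set \<Rightarrow> 'a set \<Rightarrow> 'a" where
  "gradient_measure E = (SOME D. is_gradient_measure E D)"

definition has_density :: "'a::euclidean_space set \<Rightarrow> 'a \<Rightarrow> real \<Rightarrow> bool" where
  "has_density E x d \<longleftrightarrow>
     ((\<lambda>r. measure lebesgue (E \<inter> ball x r) / measure lebesgue (ball x r)) \<longlongrightarrow> d) (at_right 0)"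

definition essential_boundary :: "'a::euclidean_space set \<Rightarrow> 'a set" where
  "essential_boundary E = - {x. has_density E x 0 \<or> has_density E x 1}"

text \<open>Meaningful only for sets of finite perimeter.  When the total variation of small balls
  vanishes, the quotient is 0 by convention and so has no unit limit.\<close>

definition reduced_boundary :: "'a::euclidean_space set \<Rightarrow> 'a set" where
  "reduced_boundary E =
     {x \<in> essential_boundary E. \<exists>\<nu>. norm \<nu> = 1 \<and>
        ((\<lambda>r. gradient_measure E (ball x r) /\<^sub>R
              enn2real (total_variation (gradient_measure E) (ball x r))) \<longlongrightarrow> \<nu>) (at_right 0)}"

section \<open>The perforated disk\<close>

definition hole_index :: "(nat \<times> nat) set" where
  "hole_index = {(j1, j2). 1 \<le> j2 \<and> j2 \<le> j1}"

text \<open>Successor in the lexicographic order on \<open>hole_index\<close>.\<close>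

definition next_index :: "nat \<times> nat \<Rightarrow> nat \<times> nat" where
  "next_index j = (if snd j = fst j then (fst j + 1, 1) else (fst j, snd j + 1))"

definition hole_angle :: "nat \<times> nat \<Rightarrow> real" where
  "hole_angle j = real (snd j) * (pi / (2 * (real (fst j) + 1)))"

definition hole_center :: "(nat \<times> nat \<Rightarrow> real) \<Rightarrow> nat \<times> nat \<Rightarrow> real ^ 2" where
  "hole_center \<epsilon> j = (1 - \<epsilon> j) *\<^sub>R vector [cos (hole_angle j), sin (hole_angle j)]"

definition hole :: "(nat \<times> nat \<Rightarrow> real) \<Rightarrow> (nat \<times> nat \<Rightarrow> real) \<Rightarrow> nat \<times> nat \<Rightarrow> (real ^ 2) set" where
  "hole \<epsilon> r j = ball (hole_center \<epsilon> j) (r j)"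

definition perforated_disk ::
    "(nat \<times> nat \<Rightarrow> real) \<Rightarrow> (nat \<times> nat \<Rightarrow> real) \<Rightarrow> (real ^ 2) set" where
  "perforated_disk \<epsilon> r = ball 0 1 - (\<Union>j \<in> hole_index. closure (hole \<epsilon> r j))"

end

theory Submission
  imports Defs
begin

text \<open>
  The topological boundary consists of the unit circle and the circles around the holes. By Gauss-Green
  on each disc (\<open>gauss_green_disc\<close>), integrating the normal that points into the domain against arc
  length on all these circles gives a gradient measure \<open>D\<close> of the domain
  (\<open>is_gradient_normal_measure\<close>); the total length is finite, so this is a vector measure. A gradient
  measure is determined by its integrals of test functions (\<open>is_gradient_measure_unique\<close>), hence the
  reduced boundary may be computed with this particular \<open>D\<close>.

  Let \<open>x\<close> lie on one of the circles, of radius \<open>R\<close> and with normal \<open>\<nu>\<close> at \<open>x\<close>. In a small ball of radius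
  \<open>\<rho>\<close> around \<open>x\<close> this circle has length at least \<open>\<rho>\<close>, and its normal differs from \<open>\<nu>\<close> by at most
  \<open>\<rho> / R\<close>. If \<open>x\<close> lies on the boundary of a hole, no other circle meets the ball, because the holes are
  disjoint and accumulate only at the unit circle. If \<open>x\<close> lies on the unit circle, a hole that meets the
  ball has depth below \<open>2 * \<rho>\<close>, and the cubic bound on the radii makes the total length of these holes
  \<open>O(\<rho>\<^sup>2)\<close>. In both cases the value of \<open>D\<close> on the ball divided by the length of all circles in the ball
  converges to \<open>\<nu>\<close> (\<open>normal_measure_ball_close\<close>). The total variation of the ball lies between the norm
  of \<open>D\<close> and that length, so it may replace the length in this limit (\<open>tendsto_div_total_variation\<close>).

  The point \<open>x\<close> is also in the essential boundary: of the two balls of radius \<open>\<rho> / 2\<close> that touch the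
  circle at \<open>x\<close>, one lies outside the domain and the other lies inside it up to holes whose area is
  \<open>O(\<rho>\<^sup>3)\<close> (\<open>in_essential_boundaryI\<close>). Conversely, a point off the topological boundary has
  density 0 or 1 and is not in the essential boundary.
\<close>

section \<open>Vector measures carried by a parametrisation\<close>

text \<open>The set function of an integral over a parameter space: \<open>\<gamma>\<close> parametrises the support of the
  vector measure and \<open>w\<close> is its density in the parameter. For a curve with normal \<open>n\<close> this is
  integration of \<open>n\<close> against arc length.\<close>
definition vector_pushforward ::
    "'z measure \<Rightarrow> ('z \<Rightarrow> 'a::topological_space) \<Rightarrow> ('z \<Rightarrow> 'b::euclidean_space) \<Rightarrow> 'a set \<Rightarrow> 'b" where
  "vector_pushforward M \<gamma> w A = (LINT z|M. indicator A (\<gamma> z) *\<^sub>R w z)"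

text \<open>The positive measure with density \<open>norm w\<close>. It dominates the total variation but may
  exceed it, because densities of opposite direction over one point of the support can cancel.\<close>
definition mass_pushforward ::
    "'z measure \<Rightarrow> ('z \<Rightarrow> 'a::topological_space) \<Rightarrow> ('z \<Rightarrow> 'b::euclidean_space) \<Rightarrow> 'a measure" where
  "mass_pushforward M \<gamma> w = distr (density M (\<lambda>z. ennreal (norm (w z)))) borel \<gamma>"

lemma integrable_indicator_comp:
  fixes w :: "'z \<Rightarrow> 'b::euclidean_space"
  assumes [measurable]: "\<gamma> \<in> borel_measurable M" "A \<in> sets borel" and w: "integrable M w"
  shows "integrable M (\<lambda>z. indicator A (\<gamma> z) *\<^sub>R w z)"
proof (rule Bochner_Integration.integrable_bound[OF w])
  show "(\<lambda>z. indicator A (\<gamma> z) *\<^sub>R w z) \<in> borel_measurable M"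
    using borel_measurable_integrable[OF w] by measurable
qed (auto simp: indicator_def)

text \<open>Partial sums of the indicators of disjoint sets are bounded by 1 and converge to the indicator of
  the union, so countable additivity is dominated convergence with the majorant \<open>norm w\<close>.\<close>
lemma vector_measure_vector_pushforward:
  fixes w :: "'z \<Rightarrow> 'b::euclidean_space"
  assumes [measurable]: "\<gamma> \<in> borel_measurable M" and w: "integrable M w"
  shows "vector_measure (vector_pushforward M \<gamma> w)"
  unfolding vector_measure_def
proof (intro allI impI, elim conjE)
  fix A :: "nat \<Rightarrow> 'a set"
  assume rA: "range A \<subseteq> sets borel" and disj: "disjoint_family A"
  have A[measurable]: "A n \<in> sets borel" for n using rA by auto
  have wm[measurable]: "w \<in> borel_measurable M" using w by simp
  have ptw: "(\<lambda>i. indicator (A i) x::real) sums indicator (\<Union>i. A i) x" for x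
    using disj by (intro indicator_sums) (auto simp: disjoint_family_on_def)
  have bnd: "(\<Sum>i<n. indicator (A i) x::real) \<le> 1" for n x
  proof -
    have "(\<Sum>i<n. indicator (A i) x::real) \<le> (\<Sum>i. indicator (A i) x)"
      using ptw[of x] by (intro sum_le_suminf) (auto simp: sums_iff)
    also have "\<dots> = indicator (\<Union>i. A i) x" using ptw[of x] by (simp add: sums_iff)
    also have "\<dots> \<le> 1" by (auto simp: indicator_def)
    finally show ?thesis .
  qed
  have "(\<lambda>n. LINT z|M. (\<Sum>i<n. indicator (A i) (\<gamma> z)) *\<^sub>R w z)
      \<longlonglongrightarrow> (LINT z|M. indicator (\<Union>i. A i) (\<gamma> z) *\<^sub>R w z)"
  proof (rule integral_dominated_convergence[where w="\<lambda>z. norm (w z)"])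
    show "AE z in M. (\<lambda>n. (\<Sum>i<n. indicator (A i) (\<gamma> z)) *\<^sub>R w z) \<longlonglongrightarrow>
        indicator (\<Union>i. A i) (\<gamma> z) *\<^sub>R w z"
      using ptw by (auto intro!: tendsto_scaleR simp: sums_def)
    show "AE z in M. norm ((\<Sum>i<n. indicator (A i) (\<gamma> z)) *\<^sub>R w z) \<le> norm (w z)" for n
    proof (rule AE_I2)
      fix z
      have "\<bar>\<Sum>i<n. indicator (A i) (\<gamma> z)::real\<bar> \<le> 1"
        using bnd[of "\<gamma> z" n] by (simp add: sum_nonneg)
      from mult_right_mono[OF this norm_ge_zero[of "w z"]]
      show "norm ((\<Sum>i<n. indicator (A i) (\<gamma> z)) *\<^sub>R w z) \<le> norm (w z)" by simp
    qed
    show "integrable M (\<lambda>z. norm (w z))" using w by simp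
    show "(\<lambda>z. indicator (\<Union>i. A i) (\<gamma> z) *\<^sub>R w z) \<in> borel_measurable M"
      using integrable_indicator_comp[OF assms(1) _ w, of "\<Union>i. A i"] by (auto intro!: sets.countable_UN)
    show "(\<lambda>z. (\<Sum>i<n. indicator (A i) (\<gamma> z)) *\<^sub>R w z) \<in> borel_measurable M" for n
      by (intro borel_measurable_scaleR borel_measurable_sum wm measurable_compose[OF assms(1)]
          borel_measurable_indicator A)
  qed
  moreover have "(LINT z|M. (\<Sum>i<n. indicator (A i) (\<gamma> z)) *\<^sub>R w z) =
      (\<Sum>i<n. vector_pushforward M \<gamma> w (A i))" for n
    unfolding vector_pushforward_def scaleR_left.sum
    by (intro Bochner_Integration.integral_sum integrable_indicator_comp w) auto
  ultimately show "(\<lambda>n. vector_pushforward M \<gamma> w (A n)) sums vector_pushforward M \<gamma> w (\<Union>n. A n)"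
    by (simp add: sums_def vector_pushforward_def)
qed

text \<open>The images of the positive and the negative part of the scalar density \<open>w \<bullet> i\<close> are the two finite
  positive measures that the signed integral asks for.\<close>
lemma has_signed_integral_vector_pushforward:
  fixes w :: "'z \<Rightarrow> 'b::euclidean_space"
  assumes \<gamma>[measurable]: "\<gamma> \<in> borel_measurable M" and w: "integrable M w"
    and \<phi>[measurable]: "\<phi> \<in> borel_measurable borel" and bnd: "\<And>x. \<bar>\<phi> x\<bar> \<le> C"
  shows "has_signed_integral \<phi> (\<lambda>A. vector_pushforward M \<gamma> w A \<bullet> i)
           (LINT z|M. \<phi> (\<gamma> z) * (w z \<bullet> i))"
proof -
  have wm[measurable]: "w \<in> borel_measurable M" using w by simp
  define p where "p z = max 0 (w z \<bullet> i)" for z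
  define q where "q z = max 0 (- (w z \<bullet> i))" for z
  have p: "integrable M p" and q: "integrable M q"
    unfolding p_def q_def using w by (auto intro!: Bochner_Integration.integrable_max)
  have pq: "w z \<bullet> i = p z - q z" "p z \<ge> 0" "q z \<ge> 0" for z by (auto simp: p_def q_def)
  have [measurable]: "p \<in> borel_measurable M" "q \<in> borel_measurable M" using p q by auto
  define part where "part u = distr (density M (\<lambda>z. ennreal (u z))) borel \<gamma>" for u :: "'z \<Rightarrow> real"
  have fin: "finite_measure (part u)" and sets: "sets (part u) = sets borel"
    and int: "integrable (part u) \<psi>" and eq: "(LINT x|part u. \<psi> x) = (LINT z|M. u z * \<psi> (\<gamma> z))"
    if u: "integrable M u" "\<And>z. u z \<ge> 0" and \<psi>[measurable]: "\<psi> \<in> borel_measurable borel"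
      and b: "\<And>x. \<bar>\<psi> x\<bar> \<le> K"
    for u \<psi> K
  proof -
    have [measurable]: "u \<in> borel_measurable M" using u by auto
    show "sets (part u) = sets borel" by (simp add: part_def)
    show "finite_measure (part u)"
    proof
      have "emeasure (part u) (space (part u)) = (\<integral>\<^sup>+z. ennreal (u z) \<partial>M)"
        by (simp add: part_def emeasure_distr emeasure_density cong: nn_integral_cong)
      also have "\<dots> = ennreal (LINT z|M. u z)"
        using u by (intro nn_integral_eq_integral) auto
      finally show "emeasure (part u) (space (part u)) \<noteq> \<infinity>" by simp
    qed
    have "integrable M (\<lambda>z. u z *\<^sub>R \<psi> (\<gamma> z))"
    proof (rule Bochner_Integration.integrable_bound[where f="\<lambda>z. K * u z"])
      show "AE x in M. norm (u x *\<^sub>R \<psi> (\<gamma> x)) \<le> norm (K * u x)"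
      proof (rule AE_I2)
        fix x
        have "u x * \<bar>\<psi> (\<gamma> x)\<bar> \<le> u x * \<bar>K\<bar>"
          using b[of "\<gamma> x"] u by (intro mult_left_mono) auto
        then show "norm (u x *\<^sub>R \<psi> (\<gamma> x)) \<le> norm (K * u x)"
          using u by (simp add: abs_mult mult.commute)
      qed
    qed (use u in auto)
    then show "integrable (part u) \<psi>"
      unfolding part_def using u by (subst integrable_distr_eq) (auto simp: integrable_density)
    show "(LINT x|part u. \<psi> x) = (LINT z|M. u z * \<psi> (\<gamma> z))"
      unfolding part_def using u by (subst integral_distr) (auto simp: integral_density)
  qed
  have diff: "(LINT x|part p. \<psi> x) - (LINT x|part q. \<psi> x) = (LINT z|M. \<psi> (\<gamma> z) * (w z \<bullet> i))"
    if \<psi>[measurable]: "\<psi> \<in> borel_measurable borel" and b: "\<And>x. \<bar>\<psi> x\<bar> \<le> K" for \<psi> K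
  proof -
    have i: "integrable M (\<lambda>z. u z * \<psi> (\<gamma> z))" if "u = p \<or> u = q" for u
    proof -
      have u: "integrable M u" "\<And>z. u z \<ge> 0" using that p q pq by auto
      have [measurable]: "u \<in> borel_measurable M" using u by auto
      from int[OF u \<psi> b] have "integrable (density M (\<lambda>z. ennreal (u z))) (\<lambda>z. \<psi> (\<gamma> z))"
        unfolding part_def by (subst (asm) integrable_distr_eq) auto
      then show ?thesis using u by (simp add: integrable_density)
    qed
    have "(LINT x|part p. \<psi> x) - (LINT x|part q. \<psi> x) =
        (LINT z|M. p z * \<psi> (\<gamma> z)) - (LINT z|M. q z * \<psi> (\<gamma> z))"
      using eq[OF p pq(2) \<psi> b] eq[OF q pq(3) \<psi> b] by simp
    also have "\<dots> = (LINT z|M. p z * \<psi> (\<gamma> z) - q z * \<psi> (\<gamma> z))"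
      using i by simp
    also have "\<dots> = (LINT z|M. \<psi> (\<gamma> z) * (w z \<bullet> i))"
      by (simp add: pq(1) algebra_simps)
    finally show ?thesis .
  qed
  show ?thesis
    unfolding has_signed_integral_def
  proof (intro exI conjI ballI)
    show "finite_measure (part p)" "finite_measure (part q)"
      "sets (part p) = sets borel" "sets (part q) = sets borel"
      "integrable (part p) \<phi>" "integrable (part q) \<phi>"
      using fin[OF p pq(2) \<phi> bnd] fin[OF q pq(3) \<phi> bnd] sets[OF p pq(2) \<phi> bnd]
        sets[OF q pq(3) \<phi> bnd] int[OF p pq(2) \<phi> bnd] int[OF q pq(3) \<phi> bnd] by auto
    show "(LINT z|M. \<phi> (\<gamma> z) * (w z \<bullet> i)) = (LINT x|part p. \<phi> x) - (LINT x|part q. \<phi> x)"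
      using diff[OF \<phi> bnd] by simp
    fix A :: "'a set" assume A[measurable]: "A \<in> sets borel"
    have "vector_pushforward M \<gamma> w A \<bullet> i = (LINT z|M. (indicator A (\<gamma> z) *\<^sub>R w z) \<bullet> i)"
      unfolding vector_pushforward_def using integrable_indicator_comp[OF \<gamma> A w]
      by (rule integral_inner_left[symmetric])
    also have "\<dots> = (LINT x|part p. indicator A x) - (LINT x|part q. indicator A x)"
      by (subst diff[where K=1]) (auto simp: indicator_def)
    finally show "vector_pushforward M \<gamma> w A \<bullet> i = measure (part p) A - measure (part q) A"
      by (simp add: part_def)
  qed
qed

context
  fixes M :: "'z measure" and \<gamma> :: "'z \<Rightarrow> 'a::topological_space" and w :: "'z \<Rightarrow> 'b::euclidean_space"
  assumes \<gamma>[measurable]: "\<gamma> \<in> borel_measurable M" and w: "integrable M w"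
begin

lemma finite_measure_mass_pushforward: "finite_measure (mass_pushforward M \<gamma> w)"
proof
  have [measurable]: "w \<in> borel_measurable M" using w by simp
  have "emeasure (mass_pushforward M \<gamma> w) (space (mass_pushforward M \<gamma> w)) = (\<integral>\<^sup>+z. ennreal (norm (w z)) \<partial>M)"
    by (simp add: mass_pushforward_def emeasure_distr emeasure_density cong: nn_integral_cong)
  also have "\<dots> = ennreal (LINT z|M. norm (w z))"
    using w by (intro nn_integral_eq_integral) auto
  finally show "emeasure (mass_pushforward M \<gamma> w) (space (mass_pushforward M \<gamma> w)) \<noteq> \<infinity>" by simp
qed

lemma measure_mass_pushforward:
  assumes A[measurable]: "A \<in> sets borel"
  shows "measure (mass_pushforward M \<gamma> w) A = (LINT z|M. indicator A (\<gamma> z) * norm (w z))"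
proof -
  have [measurable]: "w \<in> borel_measurable M" using w by simp
  have "measure (mass_pushforward M \<gamma> w) A = (LINT x|mass_pushforward M \<gamma> w. indicator A x)"
    by (simp add: mass_pushforward_def)
  also have "\<dots> = (LINT z|M. norm (w z) *\<^sub>R indicator A (\<gamma> z))"
    unfolding mass_pushforward_def by (subst integral_distr) (auto simp: integral_density)
  finally show ?thesis by (simp add: mult.commute)
qed

lemma norm_vector_pushforward_le:
  assumes A[measurable]: "A \<in> sets borel"
  shows "norm (vector_pushforward M \<gamma> w A) \<le> measure (mass_pushforward M \<gamma> w) A"
proof -
  have "norm (vector_pushforward M \<gamma> w A) \<le> (LINT z|M. norm (indicator A (\<gamma> z) *\<^sub>R w z))"
    unfolding vector_pushforward_def by (rule integral_norm_bound)
  also have "\<dots> = measure (mass_pushforward M \<gamma> w) A" by (simp add: measure_mass_pushforward)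
  finally show ?thesis .
qed

lemma total_variation_vector_pushforward_le:
  assumes B: "B \<in> sets borel"
  shows "total_variation (vector_pushforward M \<gamma> w) B \<le> ennreal (measure (mass_pushforward M \<gamma> w) B)"
  unfolding total_variation_def
proof (rule SUP_least, clarify)
  interpret mass: finite_measure "mass_pushforward M \<gamma> w" by (rule finite_measure_mass_pushforward)
  fix A :: "nat \<Rightarrow> 'a set"
  assume A: "range A \<subseteq> sets borel" "disjoint_family A" and B: "B = (\<Union>n. A n)"
  have "(\<Sum>n. ennreal (norm (vector_pushforward M \<gamma> w (A n)))) \<le>
      (\<Sum>n. emeasure (mass_pushforward M \<gamma> w) (A n))"
    using A norm_vector_pushforward_le
    by (intro suminf_le) (auto simp: mass.emeasure_eq_measure image_subset_iff)
  also have "\<dots> = emeasure (mass_pushforward M \<gamma> w) (\<Union>n. A n)"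
    using A by (intro suminf_emeasure) (auto simp: mass_pushforward_def)
  finally show "(\<Sum>n. ennreal (norm (vector_pushforward M \<gamma> w (A n)))) \<le>
      ennreal (measure (mass_pushforward M \<gamma> w) (\<Union>n. A n))"
    by (simp add: mass.emeasure_eq_measure)
qed

end

lemma norm_le_total_variation:
  assumes \<mu>: "vector_measure \<mu>" and B: "B \<in> sets borel"
  shows "ennreal (norm (\<mu> B)) \<le> total_variation \<mu> B"
proof -
  have empty: "\<mu> {} = 0"
  proof -
    have "(\<lambda>n::nat. \<mu> {}) sums \<mu> {}"
      using \<mu>[unfolded vector_measure_def, rule_format, of "\<lambda>_. {}"] by (simp add: disjoint_family_on_def)
    then have "summable (\<lambda>n::nat. \<mu> {})" by (rule sums_summable)
    then show ?thesis by (simp add: summable_const_iff)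
  qed
  \<comment> \<open>the partition of \<open>B\<close> into \<open>B\<close> itself and empty sets\<close>
  define A where "A n = (if n = 0 then B else {})" for n :: nat
  have "ennreal (norm (\<mu> B)) = (\<Sum>n\<in>{0::nat}. ennreal (norm (\<mu> (A n))))" by (simp add: A_def)
  also have "\<dots> \<le> (\<Sum>n. ennreal (norm (\<mu> (A n))))" by (rule sum_le_suminf) auto
  also have "\<dots> \<le> total_variation \<mu> B"
    unfolding total_variation_def
    by (rule SUP_upper) (use B in \<open>auto simp: A_def disjoint_family_on_def split: if_splits\<close>)
  finally show ?thesis .
qed

text \<open>Total variations of balls never have to be computed: since
  \<open>norm (\<mu> B) \<le> total_variation \<mu> B \<le> mass B\<close>, a unit limit of \<open>\<mu> B / mass B\<close> forces the outer terms to
  be asymptotically equal, and then the total variation is asymptotic to the mass as well.\<close>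
lemma tendsto_div_total_variation:
  fixes w :: "'z \<Rightarrow> 'b::euclidean_space"
  assumes \<gamma>: "\<gamma> \<in> borel_measurable M" and w: "integrable M w"
    and B: "\<And>\<rho>. B \<rho> \<in> sets borel" and \<nu>: "norm \<nu> = 1"
    and lim: "((\<lambda>\<rho>. vector_pushforward M \<gamma> w (B \<rho>) /\<^sub>R measure (mass_pushforward M \<gamma> w) (B \<rho>)) \<longlongrightarrow> \<nu>) F"
  shows "((\<lambda>\<rho>. vector_pushforward M \<gamma> w (B \<rho>) /\<^sub>R
            enn2real (total_variation (vector_pushforward M \<gamma> w) (B \<rho>))) \<longlongrightarrow> \<nu>) F"
proof -
  define D where "D \<rho> = vector_pushforward M \<gamma> w (B \<rho>)" for \<rho>
  define m where "m \<rho> = measure (mass_pushforward M \<gamma> w) (B \<rho>)" for \<rho>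
  define T where "T \<rho> = enn2real (total_variation (vector_pushforward M \<gamma> w) (B \<rho>))" for \<rho>
  have Tm: "T \<rho> \<le> m \<rho>" for \<rho>
    unfolding T_def m_def
    using enn2real_mono[OF total_variation_vector_pushforward_le[OF \<gamma> w B[of \<rho>]]] by simp
  have DT: "norm (D \<rho>) \<le> T \<rho>" for \<rho>
  proof -
    have "total_variation (vector_pushforward M \<gamma> w) (B \<rho>) < top"
      using total_variation_vector_pushforward_le[OF \<gamma> w B[of \<rho>]] ennreal_less_top
      by (rule order.strict_trans1)
    from enn2real_mono[OF norm_le_total_variation[OF vector_measure_vector_pushforward[OF \<gamma> w] B[of \<rho>]] this]
    show ?thesis by (simp add: D_def T_def)
  qed
  have lim': "((\<lambda>\<rho>. D \<rho> /\<^sub>R m \<rho>) \<longlongrightarrow> \<nu>) F" using lim by (simp add: D_def m_def)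
  have n: "((\<lambda>\<rho>. norm (D \<rho> /\<^sub>R m \<rho>)) \<longlongrightarrow> 1) F" using tendsto_norm[OF lim'] \<nu> by simp
  have ev: "\<forall>\<^sub>F \<rho> in F. norm (D \<rho> /\<^sub>R m \<rho>) > 0" using order_tendstoD(1)[OF n, of 0] by simp
  have ratio: "((\<lambda>\<rho>. T \<rho> / m \<rho>) \<longlongrightarrow> 1) F"
  proof (rule tendsto_sandwich[OF _ _ n tendsto_const])
    have m0: "m \<rho> \<ge> 0" for \<rho> by (simp add: m_def)
    show "\<forall>\<^sub>F \<rho> in F. norm (D \<rho> /\<^sub>R m \<rho>) \<le> T \<rho> / m \<rho>"
      using DT m0 by (intro always_eventually allI)
        (simp add: divide_inverse mult.commute[of "inverse _"] abs_of_nonneg mult_right_mono)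
    show "\<forall>\<^sub>F \<rho> in F. T \<rho> / m \<rho> \<le> 1"
      using Tm m0 by (intro always_eventually allI) (metis divide_le_eq_1 divide_eq_0_iff
          order.order_iff_strict zero_le_one)
  qed
  have "((\<lambda>\<rho>. (D \<rho> /\<^sub>R m \<rho>) /\<^sub>R (T \<rho> / m \<rho>)) \<longlongrightarrow> \<nu> /\<^sub>R 1) F"
    by (intro tendsto_scaleR tendsto_inverse lim' ratio) auto
  moreover have "\<forall>\<^sub>F \<rho> in F. (D \<rho> /\<^sub>R m \<rho>) /\<^sub>R (T \<rho> / m \<rho>) = D \<rho> /\<^sub>R T \<rho>"
    using ev by eventually_elim (auto simp: divide_simps)
  ultimately have "((\<lambda>\<rho>. D \<rho> /\<^sub>R T \<rho>) \<longlongrightarrow> \<nu>) F"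
    by (subst (asm) tendsto_cong) auto
  then show ?thesis unfolding D_def T_def .
qed

section \<open>Uniqueness of the gradient measure\<close>

lemma C1_test_functionI:
  assumes "\<And>x. (\<phi> has_derivative D x) (at x)" and "\<And>v. continuous_on UNIV (\<lambda>x. D x v)"
    and "bounded {x. \<phi> x \<noteq> 0}"
  shows "C1_test_function \<phi>"
proof -
  have "frechet_derivative \<phi> (at x) = D x" for x
    using frechet_derivative_at[OF assms(1)[of x]] by simp
  then show ?thesis
    unfolding C1_test_function_def using assms by (auto simp: differentiable_def)
qed

lemma C1_test_functionD:
  assumes "C1_test_function \<phi>"
  shows "(\<phi> has_derivative frechet_derivative \<phi> (at x)) (at x)"
    and "continuous_on UNIV (\<lambda>x. frechet_derivative \<phi> (at x) v)"
    and "continuous_on UNIV \<phi>"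
    and "bounded {x. \<phi> x \<noteq> 0}"
  using assms frechet_derivative_works[of \<phi> "at x"] compact_imp_bounded bounded_subset[OF _ closure_subset]
  unfolding C1_test_function_def
  by (auto simp: differentiable_imp_continuous_on differentiable_on_def differentiable_at_withinI)

lemma C1_test_function_borel: "C1_test_function \<phi> \<Longrightarrow> \<phi> \<in> borel_measurable borel"
  by (auto dest: C1_test_functionD(3) intro: borel_measurable_continuous_onI)

lemma C1_test_function_bounded:
  assumes "C1_test_function \<phi>"
  shows "\<exists>C. \<forall>x. \<bar>\<phi> x\<bar> \<le> C"
proof -
  have "compact (closure {x. \<phi> x \<noteq> 0})" using assms by (simp add: C1_test_function_def)
  then have "compact (\<phi> ` closure {x. \<phi> x \<noteq> 0})"
    by (intro compact_continuous_image continuous_on_subset[OF C1_test_functionD(3)[OF assms]]) auto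
  then have "bounded (\<phi> ` closure {x. \<phi> x \<noteq> 0})" by (rule compact_imp_bounded)
  then obtain C where C: "\<forall>y \<in> \<phi> ` closure {x. \<phi> x \<noteq> 0}. norm y \<le> C"
    unfolding bounded_iff by (elim exE)
  have "\<bar>\<phi> x\<bar> \<le> max 0 C" for x
  proof (cases "\<phi> x = 0")
    case False
    then have "x \<in> closure {x. \<phi> x \<noteq> 0}" using closure_subset[of "{x. \<phi> x \<noteq> 0}"] by auto
    then show ?thesis using C by (force simp: le_max_iff_disj)
  qed simp
  then show ?thesis by blast
qed

lemma C1_test_function_mult:
  assumes f: "C1_test_function f" and g: "C1_test_function g"
  shows "C1_test_function (\<lambda>x. f x * g x)"
proof (rule C1_test_functionI)
  show "((\<lambda>x. f x * g x) has_derivative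
      (\<lambda>v. f x * frechet_derivative g (at x) v + frechet_derivative f (at x) v * g x)) (at x)" for x
    by (intro has_derivative_mult C1_test_functionD f g)
  show "continuous_on UNIV (\<lambda>x. f x * frechet_derivative g (at x) v + frechet_derivative f (at x) v * g x)" for v
    by (intro continuous_intros C1_test_functionD f g)
  show "bounded {x. f x * g x \<noteq> 0}"
    by (rule bounded_subset[OF C1_test_functionD(4)[OF f]]) auto
qed

text \<open>For \<open>0 \<le> f \<le> 1\<close> these functions increase with \<open>n\<close> to the indicator of \<open>{x. f x > 0}\<close>; they carry
  equality of integrals over from test functions to open sets.\<close>
lemma C1_test_function_sharpen:
  assumes f: "C1_test_function f"
  shows "C1_test_function (\<lambda>x. 1 - (1 - f x) ^ n)"
proof (rule C1_test_functionI)
  show "((\<lambda>x. 1 - (1 - f x) ^ n) has_derivative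
      (\<lambda>v. of_nat n * frechet_derivative f (at x) v * (1 - f x) ^ (n - 1))) (at x)" for x
    by (auto intro!: derivative_eq_intros C1_test_functionD[OF f] simp: fun_eq_iff)
  show "continuous_on UNIV (\<lambda>x. of_nat n * frechet_derivative f (at x) v * (1 - f x) ^ (n - 1))" for v
    by (intro continuous_intros C1_test_functionD f)
  show "bounded {x. 1 - (1 - f x) ^ n \<noteq> 0}"
    by (rule bounded_subset[OF C1_test_functionD(4)[OF f]]) auto
qed

text \<open>Squaring the positive part removes its corner at 0 and so makes continuously differentiable
  cut-offs out of it.\<close>
lemma has_real_derivative_square_pos_part:
  "((\<lambda>s::real. (max 0 s)\<^sup>2) has_real_derivative 2 * max 0 s) (at s)"
proof (cases s "0::real" rule: linorder_cases)
  case less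
  have "((\<lambda>s::real. 0) has_real_derivative 2 * max 0 s) (at s)" using less by simp
  then show ?thesis
    by (rule has_field_derivative_transform_within_open[where S="{..<0}"]) (use less in auto)
next
  case greater
  have "((\<lambda>s::real. s\<^sup>2) has_real_derivative 2 * max 0 s) (at s)"
    using greater by (auto intro!: derivative_eq_intros)
  then show ?thesis
    by (rule has_field_derivative_transform_within_open[where S="{0<..}"]) (use greater in auto)
next
  case equal
  have "((\<lambda>h::real. (max 0 h)\<^sup>2 / h) \<longlongrightarrow> 0) (at 0)"
  proof (rule Lim_null_comparison)
    show "\<forall>\<^sub>F h::real in at 0. norm ((max 0 h)\<^sup>2 / h) \<le> \<bar>h\<bar>"
      by (intro always_eventually) (auto simp: max_def power2_eq_square)
    show "((\<lambda>h::real. \<bar>h\<bar>) \<longlongrightarrow> 0) (at 0)" by (rule tendsto_rabs_zero) (rule tendsto_ident_at)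
  qed
  then show ?thesis using equal by (simp add: DERIV_def)
qed

text \<open>Witness: the squared positive part of \<open>1 - (norm (x - a) / R)\<^sup>2\<close>.\<close>
lemma C1_test_function_ball_bump:
  fixes a :: "'a::euclidean_space"
  assumes R: "R > 0"
  obtains f where "C1_test_function f" "\<And>x. 0 \<le> f x \<and> f x \<le> 1" "{x. f x > 0} = ball a R"
proof -
  define s where "s x = 1 - (x - a) \<bullet> (x - a) / R\<^sup>2" for x
  define f where "f x = (max 0 (s x))\<^sup>2" for x
  have s1: "s x \<le> 1" for x by (simp add: s_def)
  have spos: "s x > 0 \<longleftrightarrow> x \<in> ball a R" for x
  proof -
    have "s x > 0 \<longleftrightarrow> (norm (x - a))\<^sup>2 < R\<^sup>2" using R by (simp add: s_def power2_norm_eq_inner)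
    also have "\<dots> \<longleftrightarrow> norm (x - a) < R" using R abs_less_iff by (metis norm_ge_zero less_eq_real_def power2_less_imp_less power_strict_mono pos2)
    finally show ?thesis by (simp add: dist_norm norm_minus_commute)
  qed
  have "C1_test_function f"
  proof (rule C1_test_functionI)
    show "(f has_derivative (\<lambda>v. 2 * max 0 (s x) * (- (2 * (v \<bullet> (x - a))) / R\<^sup>2))) (at x)" for x
    proof -
      have "(s has_derivative (\<lambda>v. - (2 * (v \<bullet> (x - a))) / R\<^sup>2)) (at x)"
        unfolding s_def using R
        by (auto intro!: derivative_eq_intros simp: inner_commute fun_eq_iff power2_eq_square divide_simps)
      from has_derivative_compose[OF this has_real_derivative_square_pos_part[unfolded has_field_derivative_def]]
      show ?thesis by (simp add: f_def[abs_def])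
    qed
    show "continuous_on UNIV (\<lambda>x. 2 * max 0 (s x) * (- (2 * (v \<bullet> (x - a))) / R\<^sup>2))" for v
      unfolding s_def by (intro continuous_intros) (use R in auto)
    show "bounded {x. f x \<noteq> 0}"
    proof (rule bounded_subset[OF bounded_ball[of a R]], rule subsetI)
      fix x assume "x \<in> {x. f x \<noteq> 0}"
      then have "s x > 0" by (auto simp: f_def max_def split: if_splits)
      then show "x \<in> ball a R" by (simp only: spos)
    qed
  qed
  moreover have "0 \<le> f x \<and> f x \<le> 1" for x
    using s1[of x] by (auto simp: f_def max_def power_le_one)
  moreover have "{x. f x > 0} = ball a R"
  proof -
    have "f x > 0 \<longleftrightarrow> s x > 0" for x by (auto simp: f_def max_def)
    then show ?thesis using spos by blast
  qed
  ultimately show ?thesis using that by blast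
qed

text \<open>A generator of the Borel sets that suits test functions: it is stable under intersection because
  products of test functions are test functions, and it contains all balls.\<close>
definition bump_supports :: "'a::euclidean_space set set" where
  "bump_supports = {{x. f x > 0} | f. C1_test_function f \<and> (\<forall>x. 0 \<le> f x \<and> f x \<le> 1)}"

lemma bump_supportsI:
  "C1_test_function f \<Longrightarrow> (\<And>x. 0 \<le> f x \<and> f x \<le> 1) \<Longrightarrow> U = {x. f x > 0} \<Longrightarrow> U \<in> bump_supports"
  unfolding bump_supports_def by blast

lemma ball_in_bump_supports:
  fixes a :: "'a::euclidean_space"
  assumes "R > 0"
  shows "ball a R \<in> bump_supports"
proof -
  obtain f where "C1_test_function f" "\<And>x. 0 \<le> f x \<and> f x \<le> 1" "{x. f x > 0} = ball a R"
    using C1_test_function_ball_bump[OF assms, of a] by blast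
  then show ?thesis by (intro bump_supportsI[of f]) auto
qed

lemma Int_stable_bump_supports: "Int_stable bump_supports"
  unfolding Int_stable_def
proof (intro ballI)
  fix U V :: "'a set" assume "U \<in> bump_supports" "V \<in> bump_supports"
  then obtain f g :: "'a \<Rightarrow> real" where f: "U = {x. f x > 0}" "C1_test_function f" "\<And>x. 0 \<le> f x" "\<And>x. f x \<le> 1"
    and g: "V = {x. g x > 0}" "C1_test_function g" "\<And>x. 0 \<le> g x" "\<And>x. g x \<le> 1"
    unfolding bump_supports_def by blast
  have "f x * g x > 0 \<longleftrightarrow> f x > 0 \<and> g x > 0" for x
    using f(3)[of x] g(3)[of x] by (auto simp: zero_less_mult_iff)
  then have "U \<inter> V = {x. f x * g x > 0}" using f(1) g(1) by auto
  moreover have "0 \<le> f x * g x \<and> f x * g x \<le> 1" for x using f g by (simp add: mult_le_one)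
  ultimately show "U \<inter> V \<in> bump_supports"
    using C1_test_function_mult[OF f(2) g(2)] by (intro bump_supportsI) auto
qed

lemma sigma_sets_bump_supports: "sigma_sets UNIV bump_supports = sets (borel :: 'a::euclidean_space measure)"
proof
  show "sigma_sets UNIV bump_supports \<subseteq> sets (borel :: 'a measure)"
  proof (intro sets.sigma_sets_subset[of _ borel, simplified] subsetI)
    fix U :: "'a set" assume "U \<in> bump_supports"
    then obtain f :: "'a \<Rightarrow> real" where f: "U = {x. f x > 0}" "C1_test_function f"
      unfolding bump_supports_def by blast
    have [measurable]: "f \<in> borel_measurable borel" using f by (simp add: C1_test_function_borel)
    have "{x \<in> space borel. f x > 0} \<in> sets borel" by measurable
    then show "U \<in> sets borel" by (simp add: f)
  qed
  have "U \<in> sigma_sets UNIV bump_supports" if "open U" for U :: "'a set"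
  proof -
    define F where "F = {ball a R | a R. R > 0 \<and> ball a R \<subseteq> U}"
    have "U = \<Union>F"
    proof
      show "U \<subseteq> \<Union>F"
      proof
        fix x assume "x \<in> U"
        with that obtain e where "e > 0" "ball x e \<subseteq> U" by (auto simp: open_contains_ball)
        then show "x \<in> \<Union>F" unfolding F_def by (intro UnionI[of "ball x e"]) auto
      qed
    qed (auto simp: F_def)
    moreover obtain F' where "F' \<subseteq> F" "countable F'" "\<Union>F' = \<Union>F"

    proof (rule Lindelof[of F])
      show "open S" if "S \<in> F" for S using that by (auto simp: F_def)
    qed blast
    moreover have "F \<subseteq> bump_supports" using ball_in_bump_supports by (auto simp: F_def)
    ultimately have "U = \<Union>F'" "countable F'" "F' \<subseteq> bump_supports" by auto
    then show ?thesis by (auto intro!: sigma_sets_UNION)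
  qed
  then show "sets (borel :: 'a measure) \<subseteq> sigma_sets UNIV bump_supports"
    unfolding borel_def by (auto intro!: sigma_sets_mono)
qed

text \<open>Dominated convergence along the sharpened bumps gives equality on the sets \<open>{x. f x > 0}\<close>, which
  generate the Borel sets and are stable under intersection.\<close>
lemma finite_measures_eqI_C1_test:
  fixes P Q :: "'a::euclidean_space measure"
  assumes P: "finite_measure P" "sets P = sets borel" and Q: "finite_measure Q" "sets Q = sets borel"
    and eq: "\<And>\<phi>. C1_test_function \<phi> \<Longrightarrow> (LINT x|P. \<phi> x) = (LINT x|Q. \<phi> x)"
  shows "P = Q"
proof (rule measure_eqI_generator_eq[OF Int_stable_bump_supports])
  interpret P: finite_measure P by fact
  interpret Q: finite_measure Q by fact
  show "sets P = sigma_sets UNIV bump_supports" "sets Q = sigma_sets UNIV bump_supports"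
    using P Q sigma_sets_bump_supports by auto
  show "range (\<lambda>n. ball (0::'a) (real (Suc n))) \<subseteq> bump_supports"
    by (auto intro!: ball_in_bump_supports simp del: of_nat_Suc)
  show "(\<Union>n. ball (0::'a) (real (Suc n))) = UNIV"
  proof -
    have "\<exists>n. norm x < real (Suc n)" for x :: 'a
      using reals_Archimedean2[of "norm x"] by (metis lessI of_nat_less_iff order_less_trans)
    then show ?thesis by (auto simp del: of_nat_Suc)
  qed
  show "emeasure P (ball 0 (real (Suc n))) \<noteq> \<infinity>" for n by simp
  fix U :: "'a set" assume "U \<in> bump_supports"
  then obtain f :: "'a \<Rightarrow> real" where f: "U = {x. f x > 0}" "C1_test_function f" "\<And>x. 0 \<le> f x" "\<And>x. f x \<le> 1"
    unfolding bump_supports_def by blast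
  have lim: "(\<lambda>n. LINT x|N. 1 - (1 - f x) ^ n) \<longlonglongrightarrow> measure N U"
    if N: "finite_measure N" "sets N = sets borel" for N
  proof -
    interpret N: finite_measure N by fact
    have sp: "space N = UNIV" using sets_eq_imp_space_eq[OF N(2)] by simp
    have fm: "f \<in> borel_measurable N" using C1_test_function_borel[OF f(2)] N
      by (simp add: measurable_cong_sets[OF N(2) refl])
    note [measurable] = fm
    have U: "U \<in> sets N" using measurable_sets[OF fm, of "{0<..}"] by (simp add: f(1) vimage_def sp)
    have "(\<lambda>n. LINT x|N. 1 - (1 - f x) ^ n) \<longlonglongrightarrow> (LINT x|N. indicator U x)"
    proof (rule integral_dominated_convergence[where w="\<lambda>_. 1"])
      show "AE x in N. (\<lambda>n. 1 - (1 - f x) ^ n) \<longlonglongrightarrow> indicator U x"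
      proof (rule AE_I2)
        fix x
        show "(\<lambda>n. 1 - (1 - f x) ^ n) \<longlonglongrightarrow> indicator U x"
        proof (cases "f x > 0")
          case True
          have "(\<lambda>n. (1 - f x) ^ n) \<longlonglongrightarrow> 0"
            using True f(4)[of x] by (intro LIMSEQ_power_zero) auto
          from tendsto_diff[OF tendsto_const[of 1] this] show ?thesis using True f by simp
        next
          case False
          then have "f x = 0" using f(3)[of x] by simp
          then show ?thesis using f by simp
        qed
      qed
      show "AE x in N. norm (1 - (1 - f x) ^ n) \<le> 1" for n
      proof (rule AE_I2)
        fix x
        have "0 \<le> (1 - f x) ^ n" "(1 - f x) ^ n \<le> 1" using f(3,4)[of x] by (auto intro: power_le_one)
        then show "norm (1 - (1 - f x) ^ n) \<le> 1" by simp
      qed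
      show "(indicator U :: _ \<Rightarrow> real) \<in> borel_measurable N" using U by simp
    qed auto
    then show ?thesis using U sp by simp
  qed
  have "measure P U = measure Q U"
    using LIMSEQ_unique[OF lim[OF P]] lim[OF Q] eq[OF C1_test_function_sharpen[OF f(2)]] by simp
  then show "emeasure P U = emeasure Q U" by (simp add: P.emeasure_eq_measure Q.emeasure_eq_measure)
qed auto

text \<open>The sum of two Borel measures. It turns an identity between differences of positive measures into
  an identity between positive measures, where uniqueness theorems apply.\<close>
definition add_measure :: "'a::topological_space measure \<Rightarrow> 'a measure \<Rightarrow> 'a measure" where
  "add_measure P Q = measure_of UNIV (sets borel) (\<lambda>A. emeasure P A + emeasure Q A)"

lemma sets_add_measure: "sets (add_measure P Q) = sets (borel :: 'a::topological_space measure)"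
  unfolding add_measure_def using sets.sigma_sets_eq[of "borel :: 'a measure"] by simp

context
  fixes P Q :: "'a::topological_space measure"
  assumes P: "sets P = sets borel" and Q: "sets Q = sets borel"
begin

lemma emeasure_add_measure:
  assumes A: "A \<in> sets borel"
  shows "emeasure (add_measure P Q) A = emeasure P A + emeasure Q A"
proof (rule emeasure_measure_of[OF add_measure_def])
  show "countably_additive (sets (add_measure P Q)) (\<lambda>A. emeasure P A + emeasure Q A)"
    unfolding countably_additive_def
  proof (intro allI impI)
    fix B :: "nat \<Rightarrow> 'a set"
    assume B: "range B \<subseteq> sets (add_measure P Q)" "disjoint_family B"
    show "(\<Sum>n. emeasure P (B n) + emeasure Q (B n)) = emeasure P (\<Union>n. B n) + emeasure Q (\<Union>n. B n)"
      using B P Q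
      by (subst suminf_add[symmetric]) (auto simp: sets_add_measure suminf_emeasure)
  qed
qed (use A in \<open>auto simp: sets_add_measure positive_def\<close>)

lemma nn_integral_add_measure:
  assumes "f \<in> borel_measurable borel"
  shows "(\<integral>\<^sup>+x. f x \<partial>add_measure P Q) = (\<integral>\<^sup>+x. f x \<partial>P) + (\<integral>\<^sup>+x. f x \<partial>Q)"
proof -
  note m = measurable_cong_sets[OF sets_add_measure refl, of P Q borel]
    measurable_cong_sets[OF P refl, of borel] measurable_cong_sets[OF Q refl, of borel]
  show ?thesis
    using assms
  proof (induction rule: borel_measurable_induct)
    case (cong f g)
    then show ?case by (simp add: fun_eq_iff cong: nn_integral_cong)
  next
    case (set A)
    then show ?case using P Q by (simp add: emeasure_add_measure sets_add_measure)
  next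
    case (mult u c)
    then show ?case by (simp add: nn_integral_cmult m distrib_left)
  next
    case (add u v)
    then show ?case by (simp add: nn_integral_add m ac_simps)
  next
    case (seq U)
    have mono: "incseq (\<lambda>i. \<integral>\<^sup>+x. U i x \<partial>N)" for N
      using seq.hyps by (auto simp: incseq_def le_fun_def intro!: nn_integral_mono)
    have "(\<integral>\<^sup>+x. (SUP i. U i) x \<partial>N) = (SUP i. \<integral>\<^sup>+x. U i x \<partial>N)" if "sets N = sets borel" for N
      unfolding SUP_apply using seq.hyps that
      by (intro nn_integral_monotone_convergence_SUP)
        (auto simp: measurable_cong_sets[OF that refl])
    then show ?case
      using seq P Q by (simp add: sets_add_measure ennreal_SUP_add[OF mono mono])
  qed
qed

lemma integral_add_measure:
  fixes f :: "'a \<Rightarrow> real"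
  assumes f: "integrable P f" "integrable Q f"
  shows "(LINT x|add_measure P Q. f x) = (LINT x|P. f x) + (LINT x|Q. f x)"
proof -
  have fm: "f \<in> borel_measurable borel"
    using f(1) by (auto simp: measurable_cong_sets[OF P refl] dest!: borel_measurable_integrable)
  have int: "integrable (add_measure P Q) f"
    using f fm unfolding integrable_iff_bounded
    by (simp add: nn_integral_add_measure measurable_cong_sets[OF sets_add_measure refl])
  have fin: "(\<integral>\<^sup>+x. ennreal (s * f x) \<partial>N) < top" if "integrable N f" "s = 1 \<or> s = -1" for N s
  proof -
    have "(\<integral>\<^sup>+x. ennreal (s * f x) \<partial>N) \<le> (\<integral>\<^sup>+x. ennreal (norm (f x)) \<partial>N)"
      using that by (intro nn_integral_mono) (auto simp: ennreal_leI)
    also have "\<dots> < top" using that unfolding integrable_iff_bounded by simp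
    finally show ?thesis .
  qed
  note fin1 = fin[OF f(1), of 1] fin[OF f(2), of 1] fin[OF f(1), of "-1"] fin[OF f(2), of "-1"]
  show ?thesis
    using fin1 fm by (simp add: real_lebesgue_integral_def[OF int] real_lebesgue_integral_def[OF f(1)]
        real_lebesgue_integral_def[OF f(2)] nn_integral_add_measure enn2real_plus)
qed

lemma measure_add_measure:
  assumes "finite_measure P" "finite_measure Q" "A \<in> sets borel"
  shows "measure (add_measure P Q) A = measure P A + measure Q A"
proof -
  have "emeasure P A < top" "emeasure Q A < top"
    using finite_measure.emeasure_finite[OF assms(1), of A] finite_measure.emeasure_finite[OF assms(2), of A]
    by (simp_all add: less_top)
  then show ?thesis
    unfolding measure_def by (simp only: emeasure_add_measure[OF assms(3)] enn2real_plus)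
qed

lemma finite_measure_add_measure:
  assumes "finite_measure P" "finite_measure Q"
  shows "finite_measure (add_measure P Q)"
proof
  interpret P: finite_measure P by fact
  interpret Q: finite_measure Q by fact
  show "emeasure (add_measure P Q) (space (add_measure P Q)) \<noteq> \<infinity>"
    by (simp add: emeasure_add_measure sets_eq_imp_space_eq[OF sets_add_measure])
qed

end

text \<open>A signed integral may use a different pair of positive measures for each integrand. Naming the pair
  makes it possible to compare the integrals with respect to two of them.\<close>
definition signed_measure_rep :: "('a::topological_space set \<Rightarrow> real) \<Rightarrow> 'a measure \<Rightarrow> 'a measure \<Rightarrow> bool" where
  "signed_measure_rep \<mu> P N \<longleftrightarrow>
     finite_measure P \<and> finite_measure N \<and> sets P = sets borel \<and> sets N = sets borel \<and>
     (\<forall>A \<in> sets borel. \<mu> A = measure P A - measure N A)"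

lemma has_signed_integral_iff:
  "has_signed_integral f \<mu> I \<longleftrightarrow>
    (\<exists>P N. signed_measure_rep \<mu> P N \<and> integrable P f \<and> integrable N f \<and> I = (LINT x|P. f x) - (LINT x|N. f x))"
  unfolding has_signed_integral_def signed_measure_rep_def by (simp only: conj_assoc)

lemma signed_measure_repD:
  assumes "signed_measure_rep \<mu> P N"
  shows "finite_measure P" "finite_measure N" "sets P = sets borel" "sets N = sets borel"
    and "A \<in> sets borel \<Longrightarrow> \<mu> A = measure P A - measure N A"
  using assms unfolding signed_measure_rep_def by blast+

lemma add_measure_rep_eq:
  assumes "signed_measure_rep \<mu> P N" "signed_measure_rep \<mu> P' N'"
  shows "add_measure P N' = add_measure P' N"
proof (rule measure_eqI)
  fix A assume "A \<in> sets (add_measure P N')"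
  then have A: "A \<in> sets borel" by (simp add: sets_add_measure)
  have "measure P A + measure N' A = measure P' A + measure N A"
    using signed_measure_repD(5)[OF assms(1) A] signed_measure_repD(5)[OF assms(2) A] by simp
  then show "emeasure (add_measure P N') A = emeasure (add_measure P' N) A"
    using signed_measure_repD(1-4)[OF assms(1)] signed_measure_repD(1-4)[OF assms(2)] A
    by (simp add: emeasure_add_measure finite_measure.emeasure_eq_measure flip: ennreal_plus)
qed (simp add: sets_add_measure)

lemma integrable_C1_test_function:
  assumes \<phi>: "C1_test_function \<phi>" and P: "finite_measure P" "sets P = sets borel"
  shows "integrable P \<phi>"
proof -
  interpret P: finite_measure P by fact
  obtain C where C: "\<forall>x. \<bar>\<phi> x\<bar> \<le> C" using C1_test_function_bounded[OF \<phi>] by blast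
  show ?thesis
  proof (rule P.integrable_const_bound)
    show "AE x in P. norm (\<phi> x) \<le> C" using C by simp
    show "\<phi> \<in> borel_measurable P"
      using C1_test_function_borel[OF \<phi>] measurable_cong_sets[OF P(2) refl] by blast
  qed
qed

text \<open>Two decompositions \<open>P - N\<close> and \<open>P' - N'\<close> of one signed measure satisfy \<open>P + N' = P' + N\<close>.\<close>
lemma integral_C1_test_rep_unique:
  assumes \<phi>: "C1_test_function \<phi>" and rep: "signed_measure_rep \<mu> P N" "signed_measure_rep \<mu> P' N'"
  shows "(LINT x|P. \<phi> x) - (LINT x|N. \<phi> x) = (LINT x|P'. \<phi> x) - (LINT x|N'. \<phi> x)"
proof -
  have "(LINT x|P. \<phi> x) + (LINT x|N'. \<phi> x) = (LINT x|P'. \<phi> x) + (LINT x|N. \<phi> x)"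
  proof -
    note fin = signed_measure_repD(1,2)[OF rep(1)] signed_measure_repD(1,2)[OF rep(2)]
    note sets = signed_measure_repD(3,4)[OF rep(1)] signed_measure_repD(3,4)[OF rep(2)]
    note int = integrable_C1_test_function[OF \<phi>]
    have "(LINT x|P. \<phi> x) + (LINT x|N'. \<phi> x) = (LINT x|add_measure P N'. \<phi> x)"
      by (rule integral_add_measure[OF sets(1,4) int[OF fin(1) sets(1)] int[OF fin(4) sets(4)], symmetric])
    also have "\<dots> = (LINT x|add_measure P' N. \<phi> x)" by (simp only: add_measure_rep_eq[OF rep])
    also have "\<dots> = (LINT x|P'. \<phi> x) + (LINT x|N. \<phi> x)"
      by (rule integral_add_measure[OF sets(3,2) int[OF fin(3) sets(3)] int[OF fin(2) sets(2)]])
    finally show ?thesis .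
  qed
  then show ?thesis by simp
qed

text \<open>Componentwise, two gradient measures \<open>P - N\<close> and \<open>P' - N'\<close> have the same integrals of all test
  functions, so \<open>P + N'\<close> and \<open>P' + N\<close> agree on test functions and hence on Borel sets.\<close>
lemma is_gradient_measure_unique:
  fixes E :: "'a::euclidean_space set"
  assumes D: "is_gradient_measure E D" and D': "is_gradient_measure E D'" and A: "A \<in> sets borel"
  shows "D A = D' A"
proof (rule euclidean_eqI)
  fix i :: 'a assume i: "i \<in> Basis"
  have ex: "\<exists>P N. signed_measure_rep (\<lambda>A. G A \<bullet> i) P N"
    and val: "\<And>\<phi> P N. C1_test_function \<phi> \<Longrightarrow> signed_measure_rep (\<lambda>A. G A \<bullet> i) P N \<Longrightarrow>
      (LINT x|P. \<phi> x) - (LINT x|N. \<phi> x) = - (LINT x:E|lebesgue. frechet_derivative \<phi> (at x) i)"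
    if G: "is_gradient_measure E G" for G
  proof -
    have rep: "\<exists>P N. signed_measure_rep (\<lambda>A. G A \<bullet> i) P N \<and>
      - (LINT x:E|lebesgue. frechet_derivative \<phi> (at x) i) = (LINT x|P. \<phi> x) - (LINT x|N. \<phi> x)"
      if "C1_test_function \<phi>" for \<phi>
    proof -
      have "has_signed_integral \<phi> (\<lambda>A. G A \<bullet> i) (- (LINT x:E|lebesgue. frechet_derivative \<phi> (at x) i))"
        using that G i by (simp add: is_gradient_measure_def)
      then show ?thesis unfolding has_signed_integral_iff by (elim exE conjE) (intro exI conjI; assumption)
    qed
    obtain \<phi> where "C1_test_function (\<phi> :: 'a \<Rightarrow> real)"
      using C1_test_function_ball_bump[of 1 "0::'a"] zero_less_one by metis
    from rep[OF this] show "\<exists>P N. signed_measure_rep (\<lambda>A. G A \<bullet> i) P N"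
      by (elim exE conjE) (intro exI, assumption)
    fix \<phi> :: "'a \<Rightarrow> real" and P N
    assume \<phi>: "C1_test_function \<phi>" and PN: "signed_measure_rep (\<lambda>A. G A \<bullet> i) P N"
    from rep[OF \<phi>] obtain P' N' where "signed_measure_rep (\<lambda>A. G A \<bullet> i) P' N'"
      "- (LINT x:E|lebesgue. frechet_derivative \<phi> (at x) i) = (LINT x|P'. \<phi> x) - (LINT x|N'. \<phi> x)"
      by (elim exE conjE) (rule that)
    then show "(LINT x|P. \<phi> x) - (LINT x|N. \<phi> x) = - (LINT x:E|lebesgue. frechet_derivative \<phi> (at x) i)"
      using integral_C1_test_rep_unique[OF \<phi> PN] by simp
  qed
  obtain P N where rep: "signed_measure_rep (\<lambda>A. D A \<bullet> i) P N"
    using ex[OF D] by (elim exE) (rule that)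
  obtain P' N' where rep': "signed_measure_rep (\<lambda>A. D' A \<bullet> i) P' N'"
    using ex[OF D'] by (elim exE) (rule that)
  note PN = signed_measure_repD(1-4)[OF rep] signed_measure_repD(1-4)[OF rep']
  have "add_measure P N' = add_measure P' N"
  proof (rule finite_measures_eqI_C1_test)
    fix \<phi> :: "'a \<Rightarrow> real" assume \<phi>: "C1_test_function \<phi>"
    show "(LINT x|add_measure P N'. \<phi> x) = (LINT x|add_measure P' N. \<phi> x)"
      using val[OF D \<phi> rep] val[OF D' \<phi> rep'] integrable_C1_test_function[OF \<phi>] PN
      by (simp add: integral_add_measure)
  qed (use PN in \<open>simp_all add: sets_add_measure finite_measure_add_measure\<close>)
  then have "measure P A + measure N' A = measure P' A + measure N A"
    using measure_add_measure[OF PN(3,8,1,6) A] measure_add_measure[OF PN(7,4,5,2) A] by simp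
  then show "D A \<bullet> i = D' A \<bullet> i" using signed_measure_repD(5)[OF rep A] signed_measure_repD(5)[OF rep' A] by simp
qed

section \<open>The Gauss-Green formula on a disc\<close>

definition plane_point :: "real \<Rightarrow> real \<Rightarrow> real ^ 2" where
  "plane_point x y = x *\<^sub>R axis 1 1 + y *\<^sub>R axis 2 1"

lemma plane_point_nth [simp]: "plane_point x y $ 1 = x" "plane_point x y $ 2 = y"
  by (simp_all add: plane_point_def axis_def)

lemma vector_eq_plane_point: "vector [x, y] = plane_point x y"
  by (simp add: vec_eq_iff forall_2)

lemma continuous_on_plane_point [continuous_intros]:
  "continuous_on S f \<Longrightarrow> continuous_on S g \<Longrightarrow> continuous_on S (\<lambda>z. plane_point (f z) (g z))"
  unfolding plane_point_def by (intro continuous_intros)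

lemma Basis_vec2: "(Basis :: (real ^ 2) set) = {axis 1 1, axis 2 1}"
  by (auto simp: Basis_vec_def UNIV_2)

lemma prod_Basis_vec2: "(\<Prod>b\<in>Basis. f (b :: real ^ 2)) = f (axis 1 1) * f (axis 2 1)"
  by (simp add: Basis_vec2 axis_eq_axis)

text \<open>Identifies Lebesgue measure on the plane of vectors with the product measure, on which Fubini's
  theorem is available.\<close>
lemma lborel_plane_point:
  "distr (lborel :: (real \<times> real) measure) borel (\<lambda>z. plane_point (fst z) (snd z)) = lborel"
proof (rule lborel_eqI[symmetric])
  have m: "(\<lambda>z. plane_point (fst z) (snd z)) \<in> borel_measurable (lborel :: (real \<times> real) measure)"
    by (simp, intro borel_measurable_continuous_onI continuous_intros)
  fix l u :: "real ^ 2" assume lu: "\<And>b. b \<in> Basis \<Longrightarrow> l \<bullet> b \<le> u \<bullet> b"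
  have le: "l $ 1 \<le> u $ 1" "l $ 2 \<le> u $ 2"
    using lu[of "axis 1 1"] lu[of "axis 2 1"] by (simp_all add: Basis_vec2 inner_axis)
  have "(\<lambda>z. plane_point (fst z) (snd z)) -` box l u = box (l $ 1, l $ 2) (u $ 1, u $ 2)"
    by (auto simp: mem_box Basis_vec2 Basis_prod_def inner_axis)
  then have "emeasure (distr (lborel :: (real \<times> real) measure) borel (\<lambda>z. plane_point (fst z) (snd z))) (box l u)
      = emeasure lborel (box (l $ 1, l $ 2) (u $ 1, u $ 2))"
    by (subst emeasure_distr[OF m]) auto
  also have "\<dots> = ennreal ((u $ 1 - l $ 1) * (u $ 2 - l $ 2))"
    using le by (subst emeasure_lborel_box) (auto simp: Basis_prod_def prod.union_disjoint)
  also have "\<dots> = (\<Prod>b\<in>Basis. (u - l) \<bullet> b)"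
    by (simp add: prod_Basis_vec2 inner_axis)
  finally show "emeasure (distr (lborel :: (real \<times> real) measure) borel (\<lambda>z. plane_point (fst z) (snd z))) (box l u)
      = (\<Prod>b\<in>Basis. (u - l) \<bullet> b)" .
qed simp

lemma Fubini_vec2:
  fixes f :: "real ^ 2 \<Rightarrow> real"
  assumes f: "integrable lborel f"
  shows "(LINT p|lborel. f p) = (LINT x|lborel. LINT y|lborel. f (plane_point x y))"
    and "(LINT p|lborel. f p) = (LINT y|lborel. LINT x|lborel. f (plane_point x y))"
proof -
  have m: "(\<lambda>z. plane_point (fst z) (snd z)) \<in> borel_measurable (lborel :: (real \<times> real) measure)"
    by (simp, intro borel_measurable_continuous_onI continuous_intros)
  have fm: "f \<in> borel_measurable borel" using f by auto
  have int: "integrable (lborel :: (real \<times> real) measure) (\<lambda>z. f (plane_point (fst z) (snd z)))"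
    using f integrable_distr_eq[OF m fm] by (simp add: lborel_plane_point)
  have eq: "(LINT p|lborel. f p) = (LINT z|(lborel :: (real \<times> real) measure). f (plane_point (fst z) (snd z)))"
    using integral_distr[OF m fm] by (simp add: lborel_plane_point)
  have int': "integrable (lborel \<Otimes>\<^sub>M lborel) (\<lambda>(x, y). f (plane_point x y))"
    using int by (simp add: lborel_prod case_prod_beta')
  show "(LINT p|lborel. f p) = (LINT x|lborel. LINT y|lborel. f (plane_point x y))"
    using lborel_pair.integral_fst[OF int'] eq by (simp add: lborel_prod case_prod_beta')
  show "(LINT p|lborel. f p) = (LINT y|lborel. LINT x|lborel. f (plane_point x y))"
    using lborel_pair.integral_snd[OF int'] eq by (simp add: lborel_prod case_prod_beta')
qed

lemma integral_reflect_shift: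
  fixes F :: "real \<Rightarrow> real"
  assumes F: "continuous_on UNIV F" and ab: "a \<le> b"
  shows "integral {a..b} (\<lambda>t. F (s - t)) = integral {s - b..s - a} F"
proof -
  have "((\<lambda>t. (- 1) *\<^sub>R F (s - t)) has_integral
      (integral {s - a..s - b} F - integral {s - b..s - a} F)) {a..b}"
    using ab by (intro has_integral_substitution_general[of "{}" a b _ "s - b" "s - a"])
      (auto intro!: derivative_eq_intros continuous_intros continuous_on_subset[OF F])
  moreover have "integral {s - a..s - b} F = 0" using ab by (cases "a = b") auto
  ultimately have "((\<lambda>t. - F (s - t)) has_integral (- integral {s - b..s - a} F)) {a..b}" by simp
  from integral_unique[OF has_integral_neg[OF this]] show ?thesis by simp
qed

text \<open>Slicing a disc in the second coordinate direction and in the first one gives the same boundary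
  integral with sine and cosine exchanged. This lemma undoes the exchange.\<close>
lemma integral_quarter_turn_reflection:
  fixes F :: "real \<Rightarrow> real"
  assumes F: "continuous_on UNIV F" and per: "\<And>t. F (t + 2 * pi) = F t"
  shows "integral {0..2 * pi} (\<lambda>t. F (pi / 2 - t)) = integral {0..2 * pi} F"
proof -
  have int: "F integrable_on {a..b}" for a b
    by (intro integrable_continuous_real continuous_on_subset[OF F]) auto
  have "integral {0..2 * pi} (\<lambda>t. F (pi / 2 - t)) = integral {- (3 * pi / 2)..pi / 2} F"
    by (subst integral_reflect_shift[OF F]) (auto simp: field_simps)
  also have "\<dots> = integral {- (3 * pi / 2)..0} F + integral {0..pi / 2} F"
    by (rule Henstock_Kurzweil_Integration.integral_combine[symmetric]) (auto simp: int)
  also have "integral {- (3 * pi / 2)..0} F = integral {- (3 * pi / 2)..0} (F \<circ> (\<lambda>t. t + 2 * pi))"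
    by (simp add: o_def per)
  also have "\<dots> = integral {pi / 2..2 * pi} F"
    by (subst integral_shift) (auto intro: continuous_on_subset[OF F] simp: field_simps)
  also have "integral {pi / 2..2 * pi} F + integral {0..pi / 2} F = integral {0..2 * pi} F"
    by (subst add.commute, rule Henstock_Kurzweil_Integration.integral_combine) (auto simp: int)
  finally show ?thesis .
qed

text \<open>The two semicircles are the graphs over the diameter \<open>{a - R..a + R}\<close>. The substitution
  \<open>x = a - R * cos t\<close> runs through the diameter from left to right; on the upper semicircle it is the
  angle \<open>pi - t\<close>, on the lower one the angle \<open>pi + t\<close>, where the sine has changed sign.\<close>
lemma integral_graph_difference_circle:
  fixes G :: "real \<Rightarrow> real \<Rightarrow> real"
  assumes G: "continuous_on UNIV (\<lambda>z. G (fst z) (snd z))" and R: "R \<ge> 0"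
  shows "integral {a - R..a + R}
      (\<lambda>x. G x (b + sqrt (R\<^sup>2 - (x - a)\<^sup>2)) - G x (b - sqrt (R\<^sup>2 - (x - a)\<^sup>2))) =
    integral {0..2 * pi} (\<lambda>t. G (a + R * cos t) (b + R * sin t) * (R * sin t))"
proof -
  have Gc: "continuous_on S (\<lambda>z. G (f z) (g z))" if "continuous_on S f" "continuous_on S g"
    for S :: "real set" and f g
    using continuous_on_compose2[OF G continuous_on_Pair[OF that]] by simp
  define k where "k x = G x (b + sqrt (R\<^sup>2 - (x - a)\<^sup>2)) - G x (b - sqrt (R\<^sup>2 - (x - a)\<^sup>2))" for x
  define F where "F t = G (a + R * cos t) (b + R * sin t) * (R * sin t)" for t
  have kc: "continuous_on S k" for S unfolding k_def by (intro continuous_intros Gc)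
  have Fc: "continuous_on S F" for S unfolding F_def by (intro continuous_intros Gc)
  have int: "F integrable_on {a..b}" for a b by (intro integrable_continuous_real Fc)
  have "((\<lambda>t. (R * sin t) *\<^sub>R k (a - R * cos t)) has_integral
      integral {a - R * cos 0..a - R * cos pi} k) {0..pi}"
  proof (rule has_integral_substitution[where c="a - R" and d="a + R"])
    show "(\<lambda>t. a - R * cos t) ` {0..pi} \<subseteq> {a - R..a + R}"
    proof clarify
      fix t
      have "\<bar>R * cos t\<bar> \<le> R" using R by (simp add: abs_mult mult_left_le)
      then show "a - R * cos t \<in> {a - R..a + R}" by auto
    qed
  qed (use R in \<open>auto intro!: derivative_eq_intros kc\<close>)
  then have "integral {a - R..a + R} k = integral {0..pi} (\<lambda>t. (R * sin t) * k (a - R * cos t))"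
    by (simp add: has_integral_iff)
  also have "\<dots> = integral {0..pi} (\<lambda>t. F (pi - t) + F (t + pi))"
  proof (rule integral_cong)
    fix t assume t: "t \<in> {0..pi}"
    have "R\<^sup>2 - (a - R * cos t - a)\<^sup>2 = (R * sin t)\<^sup>2"
      using sin_cos_squared_add[of t] by (simp add: power_mult_distrib algebra_simps flip: distrib_left)
    moreover have "R * sin t \<ge> 0" using R t by (simp add: sin_ge_zero)
    ultimately have "sqrt (R\<^sup>2 - (a - R * cos t - a)\<^sup>2) = R * sin t" by (simp only: real_sqrt_abs abs_of_nonneg)
    then show "(R * sin t) * k (a - R * cos t) = F (pi - t) + F (t + pi)"
      by (simp add: k_def F_def algebra_simps)
  qed
  also have "\<dots> = integral {0..pi} (\<lambda>t. F (pi - t)) + integral {0..pi} (F \<circ> (\<lambda>t. t + pi))"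
    unfolding o_def
    by (intro integral_add integrable_continuous_real continuous_on_compose2[OF Fc[of UNIV]] continuous_intros) auto
  also have "integral {0..pi} (\<lambda>t. F (pi - t)) = integral {0..pi} F"
    by (subst integral_reflect_shift[OF Fc]) auto
  also have "integral {0..pi} (F \<circ> (\<lambda>t. t + pi)) = integral {pi..2 * pi} F"
    by (subst integral_shift[OF Fc]) simp
  also have "integral {0..pi} F + integral {pi..2 * pi} F = integral {0..2 * pi} F"
    by (rule Henstock_Kurzweil_Integration.integral_combine) (auto simp: int)
  finally show ?thesis unfolding k_def F_def .
qed

text \<open>The fundamental theorem of calculus on each slice leaves the difference of \<open>G\<close> at the two end
  points, which lie on the circle.\<close>
lemma integral_disc_slices:
  fixes g G :: "real \<Rightarrow> real \<Rightarrow> real"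
  assumes G: "continuous_on UNIV (\<lambda>z. G (fst z) (snd z))"
    and g: "continuous_on UNIV (\<lambda>z. g (fst z) (snd z))"
    and der: "\<And>x y. (G x has_real_derivative g x y) (at y)" and R: "R \<ge> 0"
  shows "(LINT x|lborel. LINT y|lborel. indicator {y. (x - a)\<^sup>2 + (y - b)\<^sup>2 \<le> R\<^sup>2} y * g x y) =
    integral {0..2 * pi} (\<lambda>t. G (a + R * cos t) (b + R * sin t) * (R * sin t))"
proof -
  define k where "k x = G x (b + sqrt (R\<^sup>2 - (x - a)\<^sup>2)) - G x (b - sqrt (R\<^sup>2 - (x - a)\<^sup>2))" for x
  have Gc: "continuous_on S (\<lambda>z. G (f z) (h z))" if "continuous_on S f" "continuous_on S h"
    for S :: "real set" and f h
    using continuous_on_compose2[OF G continuous_on_Pair[OF that]] by simp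
  have gc: "continuous_on S (\<lambda>z. g (f z) (h z))" if "continuous_on S f" "continuous_on S h"
    for S :: "real set" and f h
    using continuous_on_compose2[OF g continuous_on_Pair[OF that]] by simp
  have kc: "continuous_on S k" for S unfolding k_def by (intro continuous_intros Gc)
  have slice: "(LINT y|lborel. indicator {y. (x - a)\<^sup>2 + (y - b)\<^sup>2 \<le> R\<^sup>2} y * g x y) =
      indicator {a - R..a + R} x *\<^sub>R k x" for x
  proof (cases "x \<in> {a - R..a + R}")
    case True
    then have "\<bar>x - a\<bar> \<le> \<bar>R\<bar>" using R by (auto simp: abs_le_iff)
    then have pos: "R\<^sup>2 - (x - a)\<^sup>2 \<ge> 0" by (simp only: abs_le_square_iff diff_ge_0_iff_ge)
    define h where "h = sqrt (R\<^sup>2 - (x - a)\<^sup>2)"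
    have h: "h \<ge> 0" "h\<^sup>2 = R\<^sup>2 - (x - a)\<^sup>2" using pos by (simp_all add: h_def)
    have "(x - a)\<^sup>2 + (y - b)\<^sup>2 \<le> R\<^sup>2 \<longleftrightarrow> \<bar>y - b\<bar> \<le> \<bar>h\<bar>" for y
      using h(2) by (simp only: abs_le_square_iff) linarith
    then have "{y. (x - a)\<^sup>2 + (y - b)\<^sup>2 \<le> R\<^sup>2} = {y. \<bar>y - b\<bar> \<le> h}"
      using h(1) by (simp only: abs_of_nonneg)
    also have "\<dots> = {b - h..b + h}" by (auto simp: abs_le_iff)
    finally have "{y. (x - a)\<^sup>2 + (y - b)\<^sup>2 \<le> R\<^sup>2} = {b - h..b + h}" .
    moreover have "(LINT y|lborel. g x y * indicator {b - h..b + h} y) = G x (b + h) - G x (b - h)"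
    proof (rule integral_FTC_Icc_real)
      show "isCont (g x) y" for y
        using gc[of UNIV "\<lambda>_. x" "\<lambda>y. y"] by (auto simp: continuous_on_eq_continuous_at)
    qed (use h der in auto)
    ultimately show ?thesis using True by (simp add: k_def h_def mult.commute)
  next
    case False
    then have "\<bar>x - a\<bar> > \<bar>R\<bar>" using R by auto
    then have "(x - a)\<^sup>2 > R\<^sup>2" using abs_le_square_iff[of "x - a" R] by linarith
    then have "{y. (x - a)\<^sup>2 + (y - b)\<^sup>2 \<le> R\<^sup>2} = {}"
    proof -
      have "\<not> (x - a)\<^sup>2 + (y - b)\<^sup>2 \<le> R\<^sup>2" for y
        using zero_le_power2[of "y - b"] \<open>(x - a)\<^sup>2 > R\<^sup>2\<close> by linarith
      then show ?thesis by simp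
    qed
    then show ?thesis using False by simp
  qed
  have "(LINT x|lborel. indicator {a - R..a + R} x *\<^sub>R k x) = integral {a - R..a + R} k"
    using set_borel_integral_eq_integral(2)[of "{a - R..a + R}" k]
      borel_integrable_compact[OF compact_Icc kc]
    by (simp add: set_lebesgue_integral_def set_integrable_def)
  then show ?thesis
    unfolding slice using integral_graph_difference_circle[OF G R, of a b] by (simp add: k_def[abs_def])
qed

definition circle_dir :: "real \<Rightarrow> real ^ 2" where
  "circle_dir t = plane_point (cos t) (sin t)"

text \<open>The outer normal at angle \<open>t\<close> is \<open>circle_dir t\<close> and the length element is \<open>R\<close> times \<open>dt\<close>. For the
  derivative in a coordinate direction, slice the disc by lines in that direction.\<close>
lemma gauss_green_disc:
  fixes \<phi> :: "real ^ 2 \<Rightarrow> real"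
  assumes der: "\<And>p. (\<phi> has_derivative D p) (at p)"
    and cont: "continuous_on UNIV (\<lambda>p. D p i)"
    and i: "i \<in> Basis" and R: "R \<ge> 0"
  shows "(LINT p:cball c R|lborel. D p i) =
    (LINT t:{0..2 * pi}|lborel. \<phi> (c + R *\<^sub>R circle_dir t) * (R * (circle_dir t \<bullet> i)))"
proof -
  have cont\<phi>: "continuous_on UNIV \<phi>"
    by (rule has_derivative_continuous_on[OF has_derivative_at_withinI[OF der]])
  have lin: "D p (s *\<^sub>R v) = s * D p v" for p s v
    using linear_scale[OF has_derivative_linear[OF der]] by simp
  have int: "integrable lborel (\<lambda>p. indicator (cball c R) p *\<^sub>R D p i)"
    by (intro borel_integrable_compact continuous_on_subset[OF cont]) auto
  have disc: "plane_point x y \<in> cball c R \<longleftrightarrow> (x - c $ 1)\<^sup>2 + (y - c $ 2)\<^sup>2 \<le> R\<^sup>2" for x y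
  proof -
    have "plane_point x y \<in> cball c R \<longleftrightarrow> (dist c (plane_point x y))\<^sup>2 \<le> R\<^sup>2"
      using R by (simp add: abs_le_square_iff[symmetric])
    also have "(dist c (plane_point x y))\<^sup>2 = (x - c $ 1)\<^sup>2 + (y - c $ 2)\<^sup>2"
      by (simp add: dist_norm norm_vec_def L2_set_def UNIV_2 power2_commute)
    finally show ?thesis .
  qed
  have ind: "indicator (cball c R) (plane_point x y) =
      (indicator {y. (x - c $ 1)\<^sup>2 + (y - c $ 2)\<^sup>2 \<le> R\<^sup>2} y :: real)"
    "indicator (cball c R) (plane_point x y) =
      (indicator {x. (y - c $ 2)\<^sup>2 + (x - c $ 1)\<^sup>2 \<le> R\<^sup>2} x :: real)" for x y
    unfolding indicator_def disc by (simp_all add: add.commute)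
  have contP: "continuous_on UNIV (\<lambda>z. f (plane_point (fst z) (snd z)))"
    "continuous_on UNIV (\<lambda>z. f (plane_point (snd z) (fst z)))"
    if "continuous_on UNIV f" for f :: "real ^ 2 \<Rightarrow> real"
    using that by (auto intro!: continuous_on_compose2[OF that] continuous_intros)
  have point: "plane_point (c $ 1 + R * cos t) (c $ 2 + R * sin t) = c + R *\<^sub>R circle_dir t" for t
    by (simp add: vec_eq_iff forall_2 circle_dir_def)
  define F where "F t = \<phi> (c + R *\<^sub>R circle_dir t) * (R * (circle_dir t \<bullet> i))" for t
  have Fc: "continuous_on S F" for S
    unfolding F_def circle_dir_def
    by (intro continuous_intros continuous_on_compose2[OF cont\<phi>]) auto
  have "(LINT p:cball c R|lborel. D p i) = integral {0..2 * pi} F"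
    using i unfolding Basis_vec2
  proof (elim insertE emptyE)
    assume i: "i = axis 2 1"
    have d: "((\<lambda>y. \<phi> (plane_point x y)) has_real_derivative D (plane_point x y) i) (at y)" for x y
    proof -
      have "((\<lambda>y. plane_point x y) has_derivative (\<lambda>h. h *\<^sub>R i)) (at y)"
        unfolding plane_point_def i by (auto intro!: derivative_eq_intros)
      from has_derivative_compose[OF this der] show ?thesis
        by (simp add: has_field_derivative_def lin mult_commute_abs)
    qed
    have "(LINT p:cball c R|lborel. D p i) =
        (LINT x|lborel. LINT y|lborel. indicator {y. (x - c $ 1)\<^sup>2 + (y - c $ 2)\<^sup>2 \<le> R\<^sup>2} y * D (plane_point x y) i)"
      unfolding set_lebesgue_integral_def
      unfolding Fubini_vec2(1)[OF int] ind(1) by simp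
    also have "\<dots> = integral {0..2 * pi} (\<lambda>t. \<phi> (plane_point (c $ 1 + R * cos t) (c $ 2 + R * sin t)) * (R * sin t))"
      by (rule integral_disc_slices[OF contP(1)[OF cont\<phi>] contP(1)[OF cont] d R])
    also have "\<dots> = integral {0..2 * pi} F"
      by (simp add: F_def[abs_def] point, simp add: i circle_dir_def inner_axis)
    finally show ?thesis .
  next
    assume i: "i = axis 1 1"
    have d: "((\<lambda>x. \<phi> (plane_point x y)) has_real_derivative D (plane_point x y) i) (at x)" for x y
    proof -
      have "((\<lambda>x. plane_point x y) has_derivative (\<lambda>h. h *\<^sub>R i)) (at x)"
        unfolding plane_point_def i by (auto intro!: derivative_eq_intros)
      from has_derivative_compose[OF this der] show ?thesis
        by (simp add: has_field_derivative_def lin mult_commute_abs)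
    qed
    have "(LINT p:cball c R|lborel. D p i) =
        (LINT y|lborel. LINT x|lborel. indicator {x. (y - c $ 2)\<^sup>2 + (x - c $ 1)\<^sup>2 \<le> R\<^sup>2} x * D (plane_point x y) i)"
      unfolding set_lebesgue_integral_def
      unfolding Fubini_vec2(2)[OF int] ind(2) by simp
    also have "\<dots> = integral {0..2 * pi} (\<lambda>t. \<phi> (plane_point (c $ 1 + R * sin t) (c $ 2 + R * cos t)) * (R * sin t))"
      by (rule integral_disc_slices[OF contP(2)[OF cont\<phi>] contP(2)[OF cont] d R])
    also have "\<dots> = integral {0..2 * pi} (\<lambda>t. F (pi / 2 - t))"
    proof -
      have "c + R *\<^sub>R circle_dir (pi / 2 - t) = plane_point (c $ 1 + R * sin t) (c $ 2 + R * cos t)" for t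
        by (simp add: vec_eq_iff forall_2 circle_dir_def cos_diff sin_diff)
      then show ?thesis by (simp add: F_def, simp add: i circle_dir_def inner_axis cos_diff)
    qed
    also have "\<dots> = integral {0..2 * pi} F"
      by (rule integral_quarter_turn_reflection[OF Fc]) (simp add: F_def circle_dir_def)
    finally show ?thesis .
  qed
  also have "\<dots> = (LINT t:{0..2 * pi}|lborel. F t)"
    using borel_integrable_compact[OF compact_Icc Fc, of 0 "2 * pi"]
    by (intro set_borel_integral_eq_integral(2)[symmetric]) (simp add: set_integrable_def)
  finally show ?thesis by (simp add: F_def)
qed

section \<open>Families of circles\<close>

lemma norm_circle_dir [simp]: "norm (circle_dir t) = 1"
  by (simp add: circle_dir_def norm_vec_def L2_set_def UNIV_2)

lemma continuous_on_circle_dir [continuous_intros]: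
  fixes S :: "'a::t2_space set"
  shows "continuous_on S f \<Longrightarrow> continuous_on S (\<lambda>z. circle_dir (f z))"
  unfolding circle_dir_def by (intro continuous_intros)

text \<open>A chord of the unit circle is at most as long as its arc.\<close>
lemma norm_circle_dir_diff_le: "norm (circle_dir s - circle_dir t) \<le> \<bar>s - t\<bar>"
proof -
  have "(norm (circle_dir s - circle_dir t))\<^sup>2 = (cos s - cos t)\<^sup>2 + (sin s - sin t)\<^sup>2"
    by (simp add: circle_dir_def norm_vec_def L2_set_def UNIV_2)
  also have "\<dots> = 2 - 2 * cos (s - t)"
  proof -
    have "(cos s - cos t)\<^sup>2 + (sin s - sin t)\<^sup>2 =
        ((sin s)\<^sup>2 + (cos s)\<^sup>2) + ((sin t)\<^sup>2 + (cos t)\<^sup>2) - 2 * (cos s * cos t + sin s * sin t)"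
      by (simp add: power2_eq_square algebra_simps)
    then show ?thesis by (simp add: cos_diff)
  qed
  also have "\<dots> = (2 * sin ((s - t) / 2))\<^sup>2"
  proof -
    have "cos (s - t) = 1 - 2 * (sin ((s - t) / 2))\<^sup>2"
      using cos_double_sin[of "(s - t) / 2"] by (simp only: mult_2 field_sum_of_halves)
    then show ?thesis by (simp add: power_mult_distrib)
  qed
  also have "\<dots> \<le> (s - t)\<^sup>2"
    using abs_sin_x_le_abs_x[of "(s - t) / 2"]
    by (subst abs_le_square_iff[symmetric]) (simp add: abs_mult)
  finally show ?thesis by (subst (asm) abs_le_square_iff[symmetric]) simp
qed

lemma sphere_eq_circle_dir:
  assumes x: "x \<in> sphere a R" and R: "R > 0"
  shows "\<exists>t\<ge>0. t < 2 * pi \<and> x = a + R *\<^sub>R circle_dir t"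
proof -
  define u where "u = (1 / R) *\<^sub>R (x - a)"
  have "norm u = 1" using x R by (simp add: u_def dist_norm norm_minus_commute)
  then have "(u $ 1)\<^sup>2 + (u $ 2)\<^sup>2 = 1"
    by (simp add: norm_vec_def L2_set_def UNIV_2)
  then obtain t where t: "0 \<le> t" "t < 2 * pi" "u $ 1 = cos t" "u $ 2 = sin t"
    by (rule sincos_total_2pi)
  have "u = circle_dir t" using t by (simp add: vec_eq_iff forall_2 circle_dir_def)
  moreover have "x = a + R *\<^sub>R u" using R by (simp add: u_def)
  ultimately show ?thesis using t by blast
qed

text \<open>The parameter \<open>(n, t)\<close> stands for the point at angle \<open>t\<close> on the \<open>n\<close>-th circle. The angle is not
  restricted here: the weight below vanishes outside one turn.\<close>
definition circle_space :: "(nat \<times> real) measure" where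
  "circle_space = count_space UNIV \<Otimes>\<^sub>M lborel"

interpretation circle_space: pair_sigma_finite "count_space (UNIV :: nat set)" "lborel :: real measure"
  by (intro pair_sigma_finite.intro sigma_finite_measure_count_space_countable sigma_finite_lborel) simp

lemma measurable_circle_space:
  assumes "\<And>n. (\<lambda>t. f (n, t)) \<in> measurable borel N"
  shows "f \<in> measurable circle_space N"
  unfolding circle_space_def using assms
  by (intro measurable_pair_measure_countable1) auto

lemma integrable_circle_space:
  fixes f :: "nat \<times> real \<Rightarrow> 'b::euclidean_space"
  assumes m: "\<And>n. (\<lambda>t. f (n, t)) \<in> borel_measurable borel"
    and bnd: "\<And>n t. norm (f (n, t)) \<le> b n * indicator {0..2 * pi} t" and b: "summable b"
  shows "integrable circle_space f"
  unfolding circle_space_def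
proof (rule circle_space.Fubini_integrable)
  have fm: "f \<in> borel_measurable circle_space" using m by (rule measurable_circle_space)
  then show "f \<in> borel_measurable (count_space UNIV \<Otimes>\<^sub>M lborel)" by (simp add: circle_space_def)
  have ind: "integrable lborel (\<lambda>t. b n * indicator {0..2 * pi} t :: real)" for n by simp
  have int: "integrable lborel (\<lambda>t. f (n, t))" for n
  proof (rule Bochner_Integration.integrable_bound[OF ind[of n]])
    show "AE t in lborel. norm (f (n, t)) \<le> norm (b n * indicator {0..2 * pi} t :: real)"
      using bnd[of n] by (intro AE_I2) (metis abs_ge_self order_trans real_norm_def)
  qed (use m in simp)
  then show "AE n in count_space UNIV. integrable lborel (\<lambda>t. f (n, t))" by simp
  have "(LINT t|lborel. norm (f (n, t))) \<le> (LINT t|lborel. b n * indicator {0..2 * pi} t)" for n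
    using int[of n] ind[of n] bnd by (intro integral_mono) auto
  then have "norm (LINT t|lborel. norm (f (n, t))) \<le> 2 * pi * b n" for n
    by (simp add: mult.commute)
  then have "summable (\<lambda>n. norm (LINT t|lborel. norm (f (n, t))))"
    by (intro summable_comparison_test'[OF summable_mult[OF b, of "2 * pi"]]) auto
  then show "integrable (count_space UNIV) (\<lambda>n. LINT t|lborel. norm (f (n, t)))"
    by (simp add: integrable_count_space_nat_iff)
qed

lemma sums_circle_space:
  fixes f :: "nat \<times> real \<Rightarrow> 'b::euclidean_space"
  assumes f: "integrable circle_space f"
  shows "(\<lambda>n. LINT t|lborel. f (n, t)) sums (LINT z|circle_space. f z)"
  using sums_integral_count_space_nat[OF circle_space.integrable_fst'[OF f[unfolded circle_space_def]]]
    circle_space.integral_fst'[OF f[unfolded circle_space_def]]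
  by (simp add: circle_space_def)

definition circle_point :: "(nat \<Rightarrow> real ^ 2) \<Rightarrow> (nat \<Rightarrow> real) \<Rightarrow> nat \<times> real \<Rightarrow> real ^ 2" where
  "circle_point a R z = a (fst z) + R (fst z) *\<^sub>R circle_dir (snd z)"

text \<open>Normal times length element: \<open>s n = 1\<close> gives the outer normal of the \<open>n\<close>-th disc, \<open>s n = -1\<close> the
  inner one.\<close>
definition circle_weight :: "(nat \<Rightarrow> real) \<Rightarrow> (nat \<Rightarrow> real) \<Rightarrow> nat \<times> real \<Rightarrow> real ^ 2" where
  "circle_weight s R z =
     (indicator {0..2 * pi} (snd z) * s (fst z) * R (fst z)) *\<^sub>R circle_dir (snd z)"

lemma circle_dir_borel [measurable]: "circle_dir \<in> borel_measurable borel"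
  by (intro borel_measurable_continuous_onI continuous_intros)

lemma circle_point_borel: "circle_point a R \<in> borel_measurable circle_space"
  unfolding circle_point_def by (intro measurable_circle_space) simp

lemma norm_circle_weight:
  "\<bar>s n\<bar> = 1 \<Longrightarrow> R n \<ge> 0 \<Longrightarrow> norm (circle_weight s R (n, t)) = R n * indicator {0..2 * pi} t"
  by (simp add: circle_weight_def abs_mult)

lemma integrable_circle_weight:
  assumes "summable R" "\<And>n. R n \<ge> 0" "\<And>n. \<bar>s n\<bar> = 1"
  shows "integrable circle_space (circle_weight s R)"
proof (rule integrable_circle_space)
  show "(\<lambda>t. circle_weight s R (n, t)) \<in> borel_measurable borel" for n
    unfolding circle_weight_def by simp
  show "norm (circle_weight s R (n, t)) \<le> R n * indicator {0..2 * pi} t" for n t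
    using assms by (simp add: norm_circle_weight)
qed fact

text \<open>Fubini's theorem for the counting measure splits the integral into one integral for each circle, and
  Gauss-Green turns each of them into an integral over the disc.\<close>
lemma sums_circle_integral_discs:
  assumes \<phi>: "C1_test_function \<phi>" and i: "i \<in> Basis"
    and R: "summable R" "\<And>n. R n \<ge> 0" and s: "\<And>n. \<bar>s n\<bar> = 1"
  shows "(\<lambda>n. s n * (LINT p:cball (a n) (R n)|lborel. frechet_derivative \<phi> (at p) i)) sums
    (LINT z|circle_space. \<phi> (circle_point a R z) * (circle_weight s R z \<bullet> i))"
proof -
  note [measurable] = circle_point_borel[of a R] C1_test_function_borel[OF \<phi>]
  have w: "integrable circle_space (\<lambda>z. circle_weight s R z \<bullet> i)"
    using integrable_circle_weight[OF R s] by (rule integrable_inner_left)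
  obtain C where C: "\<forall>x. \<bar>\<phi> x\<bar> \<le> C" using C1_test_function_bounded[OF \<phi>] by blast
  have int: "integrable circle_space (\<lambda>z. \<phi> (circle_point a R z) * (circle_weight s R z \<bullet> i))"
  proof (rule Bochner_Integration.integrable_bound[OF integrable_mult_right[OF w, of C]])
    show "(\<lambda>z. \<phi> (circle_point a R z) * (circle_weight s R z \<bullet> i)) \<in> borel_measurable circle_space"
      using borel_measurable_integrable[OF w] by measurable
    show "AE z in circle_space. norm (\<phi> (circle_point a R z) * (circle_weight s R z \<bullet> i))
        \<le> norm (C * (circle_weight s R z \<bullet> i))"
    proof (rule AE_I2)
      fix z
      have "\<bar>\<phi> (circle_point a R z)\<bar> \<le> \<bar>C\<bar>" using C abs_ge_self order_trans by metis
      then show "norm (\<phi> (circle_point a R z) * (circle_weight s R z \<bullet> i))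
          \<le> norm (C * (circle_weight s R z \<bullet> i))"
        by (simp add: abs_mult mult_right_mono)
    qed
  qed
  have "(LINT t|lborel. \<phi> (circle_point a R (n, t)) * (circle_weight s R (n, t) \<bullet> i)) =
      s n * (LINT p:cball (a n) (R n)|lborel. frechet_derivative \<phi> (at p) i)" for n
  proof -
    have "s n * (LINT p:cball (a n) (R n)|lborel. frechet_derivative \<phi> (at p) i) =
        s n * (LINT t:{0..2 * pi}|lborel. \<phi> (a n + R n *\<^sub>R circle_dir t) * (R n * (circle_dir t \<bullet> i)))"
      using gauss_green_disc[OF C1_test_functionD(1,2)[OF \<phi>] i R(2)] by simp
    also have "\<dots> = (LINT t|lborel. \<phi> (circle_point a R (n, t)) * (circle_weight s R (n, t) \<bullet> i))"
      unfolding set_lebesgue_integral_def integral_mult_right_zero[symmetric]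
      by (rule Bochner_Integration.integral_cong) (simp_all add: circle_point_def circle_weight_def)
    finally show ?thesis by simp
  qed
  then show ?thesis using sums_circle_space[OF int] by simp
qed

section \<open>A disc with shrinking holes\<close>

text \<open>The holes in a single sequence: \<open>\<epsilon> n\<close> is the depth of the \<open>n\<close>-th center below the unit circle. The
  depths decay geometrically, and the radii are small compared with the cubes of the depths.\<close>
locale shrinking_holes =
  fixes c :: "nat \<Rightarrow> real ^ 2" and \<epsilon> r :: "nat \<Rightarrow> real"
  assumes eps_pos: "0 < \<epsilon> n" and eps_less: "\<epsilon> n < 1 / 2"
    and eps_Suc: "\<epsilon> (Suc n) \<le> 3 / 10 * \<epsilon> n"
    and norm_center: "norm (c n) = 1 - \<epsilon> n"
    and r_pos: "0 < r n" and r_le: "r n \<le> \<epsilon> n ^ 3 / 2 ^ 18"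
begin

definition holed_disc :: "(real ^ 2) set" where
  "holed_disc = ball 0 1 - (\<Union>n. cball (c n) (r n))"

lemma eps_antimono: "n \<le> m \<Longrightarrow> \<epsilon> m \<le> \<epsilon> n"
proof (rule decseqD[OF decseq_SucI])
  show "\<epsilon> (Suc n) \<le> \<epsilon> n" for n using eps_Suc[of n] eps_pos[of n] by simp
qed

lemma eps_le_later: "n < m \<Longrightarrow> \<epsilon> m \<le> 3 / 10 * \<epsilon> n"
  using eps_antimono[of "Suc n" m] eps_Suc[of n] by simp

lemma summable_eps: "summable \<epsilon>"
proof (rule summable_comparison_test')
  show "summable (\<lambda>n. (3 / 10 :: real) ^ n)" by (rule summable_geometric) simp
  have "\<epsilon> n \<le> (3 / 10) ^ n" for n
  proof (induction n)
    case 0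
    show ?case using eps_less[of 0] by simp
  next
    case (Suc n)
    then show ?case using eps_Suc[of n] by simp
  qed
  then show "norm (\<epsilon> n) \<le> (3 / 10) ^ n" if "n \<ge> 0" for n using eps_pos[of n] by simp
qed

lemma r_le_eps_square: "r n \<le> \<epsilon> n * (\<epsilon> n)\<^sup>2 / 4"
proof -
  have "\<epsilon> n ^ 3 / 2 ^ 18 \<le> \<epsilon> n ^ 3 / 4"
    using eps_pos[of n] by (intro divide_left_mono) auto
  then show ?thesis using r_le[of n] by (simp add: power2_eq_square power3_eq_cube)
qed

lemma r_le_quarter_eps: "r n \<le> \<epsilon> n / 4"
proof -
  have "(\<epsilon> n)\<^sup>2 \<le> 1" using eps_pos[of n] eps_less[of n] by (intro power_le_one) auto
  then have "\<epsilon> n * (\<epsilon> n)\<^sup>2 \<le> \<epsilon> n * 1" using eps_pos[of n] by (intro mult_left_mono) auto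
  then show ?thesis using r_le_eps_square[of n] by simp
qed

text \<open>The estimate behind the behaviour at the unit circle: a hole that comes within \<open>\<rho>\<close> of a point of the
  unit circle has depth below \<open>2 * \<rho>\<close>, and the radii of all such holes add up to at most
  \<open>\<rho>\<^sup>2\<close> times the sum of the depths.\<close>
lemma r_le_of_eps_less:
  assumes "\<epsilon> n < 2 * \<rho>"
  shows "r n \<le> \<epsilon> n * \<rho>\<^sup>2"
proof -
  have "(\<epsilon> n)\<^sup>2 \<le> (2 * \<rho>)\<^sup>2" using assms eps_pos[of n] by (intro power_mono) auto
  then have "\<epsilon> n * (\<epsilon> n)\<^sup>2 \<le> \<epsilon> n * (4 * \<rho>\<^sup>2)"
    using eps_pos[of n] by (intro mult_left_mono) (auto simp: power_mult_distrib)
  then show ?thesis using r_le_eps_square[of n] by simp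
qed

lemma norm_in_hole:
  assumes "p \<in> cball (c n) (r n)"
  shows "norm p \<le> 1 - \<epsilon> n + r n" "norm p \<ge> 1 - \<epsilon> n - r n"
  using assms norm_triangle_ineq2[of p "c n"] norm_triangle_ineq2[of "c n" p] norm_center[of n]
  by (auto simp: dist_norm norm_minus_commute)

lemma hole_subset: "cball (c n) (r n) \<subseteq> ball 0 1"
  using norm_in_hole(1)[of _ n] r_le_quarter_eps[of n] eps_pos[of n] by force

text \<open>The holes lie in disjoint annuli around the origin, because the depth drops by a fixed factor and the
  radius is at most a quarter of the depth.\<close>
lemma holes_disjoint:
  assumes "n \<noteq> m"
  shows "cball (c n) (r n) \<inter> cball (c m) (r m) = {}"
proof -
  have "p \<notin> cball (c m) (r m)" if "n < m" "p \<in> cball (c n) (r n)" for n m p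
  proof
    assume "p \<in> cball (c m) (r m)"
    from norm_in_hole(2)[OF this] norm_in_hole(1)[OF that(2)] r_le_quarter_eps[of n] r_le_quarter_eps[of m]
      eps_le_later[OF that(1)] eps_pos[of n]
    show False by simp
  qed
  then show ?thesis using assms by (cases n m rule: linorder_cases) auto
qed

text \<open>The holes accumulate only at the unit circle: a smaller concentric ball meets finitely many of them.
  Removing a subfamily is needed later to isolate one hole from all the others.\<close>
lemma open_ball_minus_holes: "open (ball 0 1 - (\<Union>n\<in>N. cball (c n) (r n)))"
proof -
  have "open (ball 0 s - (\<Union>n\<in>N. cball (c n) (r n)))" if s: "s < 1" for s
  proof -
    have fin: "finite {n. (1 - s) / 2 < \<epsilon> n}"
    proof -
      have "\<forall>\<^sub>F n in sequentially. \<epsilon> n < (1 - s) / 2"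
        using s by (intro order_tendstoD(2)[OF summable_LIMSEQ_zero[OF summable_eps]]) simp
      then obtain k where k: "\<forall>n\<ge>k. \<epsilon> n < (1 - s) / 2" unfolding eventually_sequentially by blast
      have "n < k" if "(1 - s) / 2 < \<epsilon> n" for n using k[rule_format, of n] that by (cases "k \<le> n") auto
      then have "{n. (1 - s) / 2 < \<epsilon> n} \<subseteq> {..<k}" by auto
      then show ?thesis by (rule finite_subset) simp
    qed
    have "ball 0 s - (\<Union>n\<in>N. cball (c n) (r n)) =
        ball 0 s - (\<Union>n\<in>N \<inter> {n. (1 - s) / 2 < \<epsilon> n}. cball (c n) (r n))"
    proof -
      have "(1 - s) / 2 < \<epsilon> n" if "p \<in> ball 0 s" "p \<in> cball (c n) (r n)" for p n
        using norm_in_hole(2)[OF that(2)] that(1) r_le_quarter_eps[of n] eps_pos[of n] by simp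
      then show ?thesis by blast
    qed
    also have "open \<dots>" using fin by (intro open_Diff closed_UN) auto
    finally show ?thesis .
  qed
  then have "open (\<Union>s\<in>{..<1}. ball 0 s - (\<Union>n\<in>N. cball (c n) (r n)))" by (intro open_UN) auto
  moreover have "(\<Union>s\<in>{..<1}. ball 0 s - (\<Union>n\<in>N. cball (c n) (r n))) = ball 0 1 - (\<Union>n\<in>N. cball (c n) (r n))"
  proof -
    have "\<exists>s<1. norm p < s" if "norm p < 1" for p :: "real ^ 2" using dense[OF that] by auto
    then have "(\<Union>s\<in>{..<1}. ball 0 s) = ball (0 :: real ^ 2) 1" by force
    then show ?thesis by (simp only: UN_extend_simps(6)[symmetric])
  qed
  ultimately show ?thesis by simp
qed

lemma open_holed_disc: "open holed_disc"
  using open_ball_minus_holes[of UNIV] by (simp add: holed_disc_def)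

text \<open>All boundary circles in one sequence, with the unit circle in front. Its normal pointing into the
  domain is the inner normal of its disc, whereas for the holes it is the outer one.\<close>
definition ctr :: "nat \<Rightarrow> real ^ 2" where "ctr n = (case n of 0 \<Rightarrow> 0 | Suc k \<Rightarrow> c k)"
definition rad :: "nat \<Rightarrow> real" where "rad n = (case n of 0 \<Rightarrow> 1 | Suc k \<Rightarrow> r k)"
definition side :: "nat \<Rightarrow> real" where "side n = (case n of 0 \<Rightarrow> -1 | Suc k \<Rightarrow> 1)"

lemma circle_data_simps [simp]: "ctr 0 = 0" "ctr (Suc n) = c n" "rad 0 = 1" "rad (Suc n) = r n"
  "side 0 = -1" "side (Suc n) = 1"
  by (simp_all add: ctr_def rad_def side_def)

lemma rad_pos: "rad n > 0"
  using r_pos by (cases n) auto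

lemma abs_side [simp]: "\<bar>side n\<bar> = 1"
  by (cases n) auto

lemma summable_rad: "summable rad"
proof -
  have "summable r"
  proof (rule summable_comparison_test'[OF summable_eps])
    show "norm (r n) \<le> \<epsilon> n" for n using r_le_quarter_eps[of n] r_pos[of n] eps_pos[of n] by simp
  qed
  then show ?thesis using summable_Suc_iff[of rad] by simp
qed

definition boundary_point :: "nat \<times> real \<Rightarrow> real ^ 2" where
  "boundary_point = circle_point ctr rad"

definition normal_weight :: "nat \<times> real \<Rightarrow> real ^ 2" where
  "normal_weight = circle_weight side rad"

lemma boundary_point_borel [measurable]: "boundary_point \<in> borel_measurable circle_space"
  unfolding boundary_point_def by (rule circle_point_borel)

lemma integrable_normal_weight: "integrable circle_space normal_weight"
  unfolding normal_weight_def
  by (rule integrable_circle_weight) (use summable_rad rad_pos in \<open>auto intro: less_imp_le\<close>)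

definition normal_measure :: "(real ^ 2) set \<Rightarrow> real ^ 2" where
  "normal_measure = vector_pushforward circle_space boundary_point normal_weight"

text \<open>Countable additivity for the decomposition of the closed unit disc into the holes, the domain and the
  unit circle, which is a null set.\<close>
lemma integral_holed_disc:
  fixes g :: "real ^ 2 \<Rightarrow> real"
  assumes g: "continuous_on UNIV g"
  shows "(\<lambda>n. LINT p:cball (c n) (r n)|lborel. g p) sums
    ((LINT p:cball 0 1|lborel. g p) - (LINT p:holed_disc|lborel. g p))"
proof -
  define gB where "gB p = indicator (cball 0 1) p *\<^sub>R g p" for p
  have gB: "integrable lborel gB"
    unfolding gB_def by (intro borel_integrable_compact continuous_on_subset[OF g]) auto
  define \<nu> where "\<nu> = vector_pushforward lborel (\<lambda>p. p) gB"
  have \<nu>_eq: "\<nu> S = (LINT p:S|lborel. g p)" if "S \<subseteq> cball 0 1" for S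
    unfolding \<nu>_def vector_pushforward_def set_lebesgue_integral_def gB_def
    by (rule Bochner_Integration.integral_cong) (use that in \<open>auto simp: indicator_def\<close>)
  \<comment> \<open>the unit circle is put with the domain in order to cover the whole closed disc\<close>
  define A where "A n = (case n of 0 \<Rightarrow> holed_disc \<union> sphere 0 1 | Suc k \<Rightarrow> cball (c k) (r k))" for n
  have sub: "cball (c n) (r n) \<subseteq> cball 0 1" for n using hole_subset[of n] ball_subset_cball by blast
  have "range A \<subseteq> sets borel" using open_holed_disc by (auto simp: A_def split: nat.split)
  moreover have "disjoint_family A"
  proof -
    have "A 0 \<inter> A (Suc k) = {}" for k using hole_subset[of k] by (force simp: A_def holed_disc_def)
    moreover have "A (Suc k) \<inter> A (Suc l) = {}" if "k \<noteq> l" for k l using holes_disjoint[OF that] by (simp add: A_def)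
    ultimately have "A n \<inter> A m = {}" if "n \<noteq> m" for n m
      using that by (cases n; cases m) (auto simp del: Int_iff simp: Int_commute)
    then show ?thesis by (auto simp: disjoint_family_on_def)
  qed
  moreover have "vector_measure \<nu>"
    unfolding \<nu>_def using gB by (intro vector_measure_vector_pushforward) auto
  ultimately have "(\<lambda>n. \<nu> (A n)) sums \<nu> (\<Union>n. A n)" unfolding vector_measure_def by simp
  moreover have "(\<Union>n. A n) = cball 0 1"
  proof
    show "(\<Union>n. A n) \<subseteq> cball 0 1"
    proof (rule UN_least)
      show "A n \<subseteq> cball 0 1" for n
        using sub by (cases n) (auto simp: A_def holed_disc_def simp del: mem_cball)
    qed
    show "cball 0 1 \<subseteq> (\<Union>n. A n)"
    proof
      fix p :: "real ^ 2" assume "p \<in> cball 0 1"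
      then consider "p \<in> A 0" | n where "p \<in> A (Suc n)"
        by (auto simp: A_def holed_disc_def le_less)
      then show "p \<in> (\<Union>n. A n)" by cases auto
    qed
  qed
  ultimately have "(\<lambda>n. \<nu> (A (Suc n))) sums (\<nu> (cball 0 1) - \<nu> (A 0))"
    using sums_Suc_iff[of "\<lambda>n. \<nu> (A n)" "\<nu> (cball 0 1) - \<nu> (A 0)"] by simp
  moreover have "\<nu> (A (Suc n)) = (LINT p:cball (c n) (r n)|lborel. g p)" for n
    using \<nu>_eq[OF sub] by (simp add: A_def)
  moreover have "\<nu> (A 0) = (LINT p:holed_disc|lborel. g p)"
  proof -
    have "\<nu> (A 0) = (LINT p:holed_disc \<union> sphere 0 1|lborel. g p)"
      by (subst \<nu>_eq) (auto simp: A_def holed_disc_def)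
    also have "\<dots> = (LINT p:holed_disc|lborel. g p)"
    proof -
      have "sphere 0 1 \<in> null_sets (lborel :: (real ^ 2) measure)"
        using negligible_sphere[of "0 :: real ^ 2" 1]
        by (simp add: negligible_iff_null_sets null_sets_completion_iff)
      then have ae: "AE p in lborel. p \<notin> sphere (0 :: real ^ 2) 1" by (rule AE_not_in)
      have gm: "g \<in> borel_measurable borel" using g by (rule borel_measurable_continuous_onI)
      have hm: "holed_disc \<in> sets borel" using open_holed_disc by simp
      show ?thesis
        unfolding set_lebesgue_integral_def
      proof (rule integral_cong_AE)
        show "AE p in lborel. indicator (holed_disc \<union> sphere 0 1) p *\<^sub>R g p = indicator holed_disc p *\<^sub>R g p"
          using ae by eventually_elim (auto simp: indicator_def)
        have "holed_disc \<union> sphere 0 1 \<in> sets borel" using hm by (intro sets.Un) auto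
        then show "(\<lambda>p. indicator (holed_disc \<union> sphere 0 1) p *\<^sub>R g p) \<in> borel_measurable lborel"
          "(\<lambda>p. indicator holed_disc p *\<^sub>R g p) \<in> borel_measurable lborel"
          using gm hm by (simp_all only: measurable_lborel2, auto intro!: borel_measurable_scaleR borel_measurable_indicator simp del: real_scaleR_def)
      qed
    qed
    finally show ?thesis .
  qed
  ultimately show ?thesis using \<nu>_eq[of "cball 0 1"] by simp
qed

text \<open>Gauss-Green on the unit disc minus Gauss-Green on every hole.\<close>
lemma is_gradient_normal_measure: "is_gradient_measure holed_disc normal_measure"
  unfolding is_gradient_measure_def
proof (intro conjI allI impI ballI)
  show "vector_measure normal_measure"
    unfolding normal_measure_def
    by (rule vector_measure_vector_pushforward[OF boundary_point_borel integrable_normal_weight])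
  fix \<phi> :: "real ^ 2 \<Rightarrow> real" and i :: "real ^ 2"
  assume \<phi>: "C1_test_function \<phi>" and i: "i \<in> Basis"
  define g where "g p = frechet_derivative \<phi> (at p) i" for p
  have g: "continuous_on UNIV g" unfolding g_def by (rule C1_test_functionD(2)[OF \<phi>])
  define I where "I = (LINT z|circle_space. \<phi> (boundary_point z) * (normal_weight z \<bullet> i))"
  have "(\<lambda>n. side n * (LINT p:cball (ctr n) (rad n)|lborel. g p)) sums I"
    unfolding I_def boundary_point_def normal_weight_def g_def
    using \<phi> i summable_rad rad_pos by (intro sums_circle_integral_discs) (auto intro: less_imp_le)
  then have "(\<lambda>n. LINT p:cball (c n) (r n)|lborel. g p) sums (I + (LINT p:cball 0 1|lborel. g p))"
    using sums_Suc_iff[of "\<lambda>n. side n * (LINT p:cball (ctr n) (rad n)|lborel. g p)"] by simp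
  from sums_unique2[OF this integral_holed_disc[OF g]]
  have "I = - (LINT p:holed_disc|lborel. g p)" by simp
  also have "(LINT p:holed_disc|lborel. g p) = (LINT p:holed_disc|lebesgue. g p)"
  proof -
    have "(\<lambda>p. indicator holed_disc p *\<^sub>R g p) \<in> borel_measurable lborel"
      using borel_measurable_continuous_onI[OF g] open_holed_disc
      by (auto intro!: borel_measurable_scaleR borel_measurable_indicator)
    then show ?thesis unfolding set_lebesgue_integral_def by (rule integral_completion[symmetric])
  qed
  finally have I: "I = - (LINT p:holed_disc|lebesgue. g p)" .
  obtain C where C: "\<forall>x. \<bar>\<phi> x\<bar> \<le> C" using C1_test_function_bounded[OF \<phi>] by blast
  have "has_signed_integral \<phi> (\<lambda>A. normal_measure A \<bullet> i) I"
    unfolding normal_measure_def I_def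
    by (rule has_signed_integral_vector_pushforward[OF boundary_point_borel integrable_normal_weight
          C1_test_function_borel[OF \<phi>] C[rule_format]])
  then show "has_signed_integral \<phi> (\<lambda>A. normal_measure A \<bullet> i)
      (- (LINT x:holed_disc|lebesgue. frechet_derivative \<phi> (at x) i))"
    by (simp add: I g_def)
qed

lemma finite_perimeter_holed_disc: "finite_perimeter holed_disc"
  unfolding finite_perimeter_def
  using is_gradient_normal_measure open_holed_disc by (auto simp: lborelD)

end

section \<open>Density at the boundary and the reduced boundary\<close>

lemma total_variation_cong:
  assumes "\<And>A. A \<in> sets borel \<Longrightarrow> \<mu> A = \<nu> A"
  shows "total_variation \<mu> B = total_variation \<nu> B"
  unfolding total_variation_def
  by (intro SUP_cong refl suminf_cong) (use assms in \<open>auto simp: image_subset_iff\<close>)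

text \<open>Uniqueness makes the chosen gradient measure and its total variation computable from any
  explicit gradient measure.\<close>
lemma in_reduced_boundaryI:
  fixes w :: "'z \<Rightarrow> 'a::euclidean_space"
  assumes \<gamma>: "\<gamma> \<in> borel_measurable M" and w: "integrable M w"
    and grad: "is_gradient_measure E (vector_pushforward M \<gamma> w)"
    and x: "x \<in> essential_boundary E" and \<nu>: "norm \<nu> = 1"
    and lim: "((\<lambda>\<rho>. vector_pushforward M \<gamma> w (ball x \<rho>) /\<^sub>R
                 measure (mass_pushforward M \<gamma> w) (ball x \<rho>)) \<longlongrightarrow> \<nu>) (at_right 0)"
  shows "x \<in> reduced_boundary E"
proof -
  have "is_gradient_measure E (gradient_measure E)"
    unfolding gradient_measure_def using someI[of "is_gradient_measure E", OF grad] .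
  then have eq: "gradient_measure E A = vector_pushforward M \<gamma> w A" if "A \<in> sets borel" for A
    using grad that by (rule is_gradient_measure_unique)
  have "((\<lambda>\<rho>. vector_pushforward M \<gamma> w (ball x \<rho>) /\<^sub>R
      enn2real (total_variation (vector_pushforward M \<gamma> w) (ball x \<rho>))) \<longlongrightarrow> \<nu>) (at_right 0)"
    by (rule tendsto_div_total_variation[OF \<gamma> w _ \<nu> lim]) simp
  moreover have "vector_pushforward M \<gamma> w (ball x \<rho>) = gradient_measure E (ball x \<rho>)" for \<rho>
    by (rule eq[symmetric]) simp
  moreover have "total_variation (vector_pushforward M \<gamma> w) B = total_variation (gradient_measure E) B" for B
    by (rule total_variation_cong) (rule eq[symmetric])
  ultimately have "((\<lambda>\<rho>. gradient_measure E (ball x \<rho>) /\<^sub>R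
      enn2real (total_variation (gradient_measure E) (ball x \<rho>))) \<longlongrightarrow> \<nu>) (at_right 0)"
    by simp
  then show ?thesis unfolding reduced_boundary_def using x \<nu> by blast
qed

text \<open>Small balls around an interior point lie in \<open>E\<close>, small balls around an exterior point miss \<open>E\<close>.\<close>
lemma essential_boundary_subset_frontier:
  fixes E :: "'a::euclidean_space set"
  shows "essential_boundary E \<subseteq> frontier E"
proof
  fix x assume x: "x \<in> essential_boundary E"
  have small: "\<forall>\<^sub>F \<rho> in at_right 0. ball x \<rho> \<subseteq> U" if U: "open U" "x \<in> U" for U
  proof -
    obtain d where d: "d > 0" "ball x d \<subseteq> U" using U unfolding open_contains_ball by blast
    then show ?thesis unfolding eventually_at_right_field
      by (intro exI[of _ d]) (auto intro: subset_trans[OF subset_ball])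
  qed
  have pos: "\<forall>\<^sub>F \<rho>::real in at_right 0. \<rho> > 0" by (rule eventually_at_right_less)
  show "x \<in> frontier E"
  proof (rule ccontr)
    assume "x \<notin> frontier E"
    then consider "x \<in> interior E" | "x \<in> - closure E" by (auto simp: frontier_def)
    then have "has_density E x 1 \<or> has_density E x 0"
    proof cases
      case 1
      have "\<forall>\<^sub>F \<rho> in at_right 0. measure lebesgue (E \<inter> ball x \<rho>) / measure lebesgue (ball x \<rho>) = 1"
        using small[OF open_interior 1] pos
      proof eventually_elim
        case (elim \<rho>)
        then have "E \<inter> ball x \<rho> = ball x \<rho>" using interior_subset[of E] by blast
        then show ?case using content_ball_pos[OF elim(2), of x] by simp
      qed
      then have "has_density E x 1" unfolding has_density_def by (rule tendsto_eventually)
      then show ?thesis by simp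
    next
      case 2
      have "\<forall>\<^sub>F \<rho> in at_right 0. measure lebesgue (E \<inter> ball x \<rho>) / measure lebesgue (ball x \<rho>) = 0"
        using small[OF open_Compl[OF closed_closure] 2]
      proof eventually_elim
        case (elim \<rho>)
        then have "E \<inter> ball x \<rho> = {}" using closure_subset[of E] by blast
        then show ?case by simp
      qed
      then have "has_density E x 0" unfolding has_density_def by (rule tendsto_eventually)
      then show ?thesis by simp
    qed
    then show False using x by (auto simp: essential_boundary_def)
  qed
qed

lemma measure_lebesgue_ball_plane:
  fixes x :: "real ^ 2"
  assumes "\<rho> \<ge> 0"
  shows "measure lebesgue (ball x \<rho>) = \<rho>\<^sup>2 * measure lebesgue (ball (0 :: real ^ 2) 1)"
    and "measure lebesgue (cball x \<rho>) = \<rho>\<^sup>2 * measure lebesgue (ball (0 :: real ^ 2) 1)"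
  using assms content_ball_conv_unit_ball[of \<rho> x] content_cball_conv_ball[of x \<rho>] by simp_all

text \<open>The two balls of radius \<open>\<rho> / 2\<close> that touch a sphere at a point from outside and from inside.\<close>
lemma tangent_balls:
  fixes a u :: "'a::euclidean_space"
  assumes u: "norm u = 1" and R: "R > 0" and \<rho>: "\<rho> > 0"
  shows "ball (a + R *\<^sub>R u + (\<rho> / 2) *\<^sub>R u) (\<rho> / 2) \<inter> cball a R = {}"
    and "\<rho> / 2 \<le> R \<Longrightarrow> ball (a + R *\<^sub>R u - (\<rho> / 2) *\<^sub>R u) (\<rho> / 2) \<subseteq> ball a R"
    and "ball (x + (\<rho> / 2) *\<^sub>R u) (\<rho> / 2) \<subseteq> ball x \<rho>"
    and "ball (x - (\<rho> / 2) *\<^sub>R u) (\<rho> / 2) \<subseteq> ball x \<rho>"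
proof -
  have "y \<notin> cball a R" if "y \<in> ball (a + R *\<^sub>R u + (\<rho> / 2) *\<^sub>R u) (\<rho> / 2)" for y
  proof -
    have "R + \<rho> / 2 = norm ((R + \<rho> / 2) *\<^sub>R u)" using R \<rho> u by simp
    also have "(R + \<rho> / 2) *\<^sub>R u = (a + R *\<^sub>R u + (\<rho> / 2) *\<^sub>R u - y) + (y - a)" by (simp add: algebra_simps)
    also have "norm \<dots> \<le> norm (a + R *\<^sub>R u + (\<rho> / 2) *\<^sub>R u - y) + norm (y - a)" by (rule norm_triangle_ineq)
    also have "\<dots> < \<rho> / 2 + norm (y - a)" using that by (simp add: dist_norm)
    finally show ?thesis by (simp add: dist_norm norm_minus_commute)
  qed
  then show "ball (a + R *\<^sub>R u + (\<rho> / 2) *\<^sub>R u) (\<rho> / 2) \<inter> cball a R = {}" by blast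
  show "ball (a + R *\<^sub>R u - (\<rho> / 2) *\<^sub>R u) (\<rho> / 2) \<subseteq> ball a R" if "\<rho> / 2 \<le> R"
  proof
    fix y assume y: "y \<in> ball (a + R *\<^sub>R u - (\<rho> / 2) *\<^sub>R u) (\<rho> / 2)"
    have "norm (y - a) = norm ((y - (a + R *\<^sub>R u - (\<rho> / 2) *\<^sub>R u)) + (R - \<rho> / 2) *\<^sub>R u)"
      by (simp add: algebra_simps)
    also have "\<dots> \<le> norm (y - (a + R *\<^sub>R u - (\<rho> / 2) *\<^sub>R u)) + norm ((R - \<rho> / 2) *\<^sub>R u)"
      by (rule norm_triangle_ineq)
    also have "\<dots> < \<rho> / 2 + (R - \<rho> / 2)" using y u that by (simp add: dist_norm norm_minus_commute)
    finally show "y \<in> ball a R" by (simp add: dist_norm norm_minus_commute)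
  qed
  show "ball (x + (\<rho> / 2) *\<^sub>R u) (\<rho> / 2) \<subseteq> ball x \<rho>" "ball (x - (\<rho> / 2) *\<^sub>R u) (\<rho> / 2) \<subseteq> ball x \<rho>"
    using u \<rho> by (auto simp: ball_subset_ball_iff dist_norm)
qed

text \<open>In the plane a ball of half the radius has a quarter of the area. One such ball outside \<open>E\<close> keeps the
  density below \<open>3 / 4\<close>; one inside \<open>E\<close>, up to an exceptional set of at most an eighth, keeps it above
  \<open>1 / 8\<close>.\<close>
lemma in_essential_boundaryI:
  fixes x :: "real ^ 2"
  assumes E: "E \<in> sets lebesgue" and \<delta>: "\<delta> > 0"
    and near: "\<And>\<rho>. 0 < \<rho> \<Longrightarrow> \<rho> < \<delta> \<Longrightarrow> \<exists>p q H. ball p (\<rho> / 2) \<subseteq> ball x \<rho> \<and> ball q (\<rho> / 2) \<subseteq> ball x \<rho> \<and>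
       ball p (\<rho> / 2) - H \<subseteq> E \<and> ball q (\<rho> / 2) \<inter> E = {} \<and>
       H \<in> lmeasurable \<and> measure lebesgue H \<le> \<rho>\<^sup>2 * measure lebesgue (ball (0 :: real ^ 2) 1) / 8"
  shows "x \<in> essential_boundary E"
proof -
  define V where "V = measure lebesgue (ball (0 :: real ^ 2) 1)"
  have V: "V > 0" unfolding V_def using content_ball_pos[of 1 "0 :: real ^ 2"] by simp
  define f where "f \<rho> = measure lebesgue (E \<inter> ball x \<rho>) / measure lebesgue (ball x \<rho>)" for \<rho>
  have bounds: "1 / 8 \<le> f \<rho>" "f \<rho> \<le> 3 / 4" if \<rho>: "0 < \<rho>" "\<rho> < \<delta>" for \<rho>
  proof -
    obtain p q H where pq: "ball p (\<rho> / 2) \<subseteq> ball x \<rho>" "ball q (\<rho> / 2) \<subseteq> ball x \<rho>"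
      and pE: "ball p (\<rho> / 2) - H \<subseteq> E" and qE: "ball q (\<rho> / 2) \<inter> E = {}"
      and H: "H \<in> lmeasurable" "measure lebesgue H \<le> \<rho>\<^sup>2 * V / 8"
      using near[OF \<rho>] unfolding V_def by (elim exE conjE)
    have half: "measure lebesgue (ball y (\<rho> / 2)) = \<rho>\<^sup>2 * V / 4" for y :: "real ^ 2"
      using \<rho> measure_lebesgue_ball_plane(1)[of "\<rho> / 2" y] by (simp add: V_def power_divide)
    have full: "measure lebesgue (ball x \<rho>) = \<rho>\<^sup>2 * V"
      using \<rho> measure_lebesgue_ball_plane(1)[of \<rho> x] by (simp add: V_def)
    have EB: "E \<inter> ball x \<rho> \<in> lmeasurable"
      using E by (intro bounded_set_imp_lmeasurable) (auto intro: bounded_subset[OF bounded_ball])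
    have "\<rho>\<^sup>2 * V / 4 \<le> measure lebesgue ((E \<inter> ball x \<rho>) \<union> H)"
      unfolding half[of p, symmetric]
      by (rule measure_mono_fmeasurable) (use EB H pE pq in auto)
    also have "\<dots> \<le> measure lebesgue (E \<inter> ball x \<rho>) + \<rho>\<^sup>2 * V / 8"
      using measure_Un_le[of "E \<inter> ball x \<rho>" lebesgue H] EB H by (auto simp: fmeasurableD)
    finally have low: "\<rho>\<^sup>2 * V / 8 \<le> measure lebesgue (E \<inter> ball x \<rho>)" by linarith
    have "measure lebesgue (E \<inter> ball x \<rho>) + \<rho>\<^sup>2 * V / 4 =
        measure lebesgue ((E \<inter> ball x \<rho>) \<union> ball q (\<rho> / 2))"
    proof -
      have "(E \<inter> ball x \<rho>) \<inter> ball q (\<rho> / 2) = {}" using qE by blast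
      then show ?thesis
        using measure_Un3[OF EB lmeasurable_ball, of q "\<rho> / 2"] by (simp add: half)
    qed
    also have "\<dots> \<le> \<rho>\<^sup>2 * V"
      unfolding full[symmetric]
      by (rule measure_mono_fmeasurable) (use EB pq in auto)
    finally have up: "measure lebesgue (E \<inter> ball x \<rho>) \<le> 3 / 4 * (\<rho>\<^sup>2 * V)" by linarith
    have "\<rho>\<^sup>2 * V > 0" using \<rho> V by simp
    then show "1 / 8 \<le> f \<rho>" "f \<rho> \<le> 3 / 4"
      using low up unfolding f_def full by (simp_all add: field_simps)
  qed
  have ev: "\<forall>\<^sub>F \<rho> in at_right 0. 0 < \<rho> \<and> \<rho> < \<delta>"
    unfolding eventually_at_right_field using \<delta> by blast
  have "\<forall>\<^sub>F \<rho> in at_right 0. 1 / 8 \<le> f \<rho>" "\<forall>\<^sub>F \<rho> in at_right 0. f \<rho> \<le> 3 / 4"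
    using eventually_mono[OF ev, of "\<lambda>\<rho>. 1 / 8 \<le> f \<rho>"] eventually_mono[OF ev, of "\<lambda>\<rho>. f \<rho> \<le> 3 / 4"] bounds
    by blast+
  then have "\<not> (f \<longlongrightarrow> 0) (at_right 0)" "\<not> (f \<longlongrightarrow> 1) (at_right 0)"
    using tendsto_lowerbound[of f 0 "at_right 0" "1 / 8"] tendsto_upperbound[of f 1 "at_right 0" "3 / 4"]
    by (auto simp: trivial_limit_at_right_real)
  then show ?thesis
    unfolding essential_boundary_def has_density_def f_def[abs_def] by simp
qed

context shrinking_holes
begin

lemma hole_near_outer_circle:
  assumes x: "x \<in> sphere 0 1" and p: "p \<in> cball (c n) (r n)" "p \<in> ball x \<rho>"
  shows "\<epsilon> n < 2 * \<rho>"
proof -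
  have "1 - norm p < \<rho>"
    using x p(2) norm_triangle_ineq2[of x p] by (simp add: dist_norm)
  then show ?thesis using norm_in_hole(1)[OF p(1)] r_le_quarter_eps[of n] eps_pos[of n] by simp
qed

text \<open>All holes that can come within \<open>\<rho>\<close> of a point of the unit circle together have area of order
  \<open>\<rho> ^ 3\<close>, which is negligible against the area of a ball of radius \<open>\<rho>\<close>.\<close>
lemma measure_small_holes:
  assumes \<rho>: "\<rho> \<ge> 0"
  defines "H \<equiv> (\<Union>n\<in>{n. \<epsilon> n < 2 * \<rho>}. cball (c n) (r n))"
  shows "H \<in> lmeasurable" and "measure lebesgue H \<le> \<rho> ^ 3 * (\<Sum>n. \<epsilon> n) * measure lebesgue (ball (0 :: real ^ 2) 1)"
proof -
  define V where "V = measure lebesgue (ball (0 :: real ^ 2) 1)"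
  have V: "V \<ge> 0" by (simp add: V_def)
  have "H \<subseteq> ball 0 1" using hole_subset unfolding H_def by blast
  then have "bounded H" using bounded_ball bounded_subset by blast
  moreover have "H \<in> sets lebesgue" unfolding H_def by (intro sets.countable_UN') auto
  ultimately show H: "H \<in> lmeasurable" by (rule bounded_set_imp_lmeasurable)
  define A where "A n = (if \<epsilon> n < 2 * \<rho> then cball (c n) (r n) else {})" for n
  have bnd: "emeasure lebesgue (A n) \<le> ennreal (\<epsilon> n * (\<rho> ^ 3 * V))" for n
  proof (cases "\<epsilon> n < 2 * \<rho>")
    case True
    have "r n \<le> \<rho>" using r_le_quarter_eps[of n] eps_pos[of n] True by simp
    then have "r n * r n \<le> (\<epsilon> n * \<rho>\<^sup>2) * \<rho>"
      using r_le_of_eps_less[OF True] r_pos[of n] eps_pos[of n] by (intro mult_mono) auto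
    then have "(r n * r n) * V \<le> (\<epsilon> n * \<rho>\<^sup>2) * \<rho> * V" using V by (rule mult_right_mono)
    also have "(r n * r n) * V = (r n)\<^sup>2 * V" by (simp only: power2_eq_square)
    also have "(\<epsilon> n * \<rho>\<^sup>2) * \<rho> * V = \<epsilon> n * (\<rho> ^ 3 * V)"
      by (simp only: power2_eq_square power3_eq_cube mult.assoc)
    finally have "(r n)\<^sup>2 * V \<le> \<epsilon> n * (\<rho> ^ 3 * V)" .
    moreover have "emeasure lebesgue (A n) = ennreal ((r n)\<^sup>2 * V)"
      using True r_pos[of n] measure_lebesgue_ball_plane(2)[of "r n" "c n"]
      by (simp add: A_def emeasure_eq_measure2 V_def)
    ultimately show ?thesis by (simp add: ennreal_leI)
  qed (simp add: A_def)
  have "emeasure lebesgue H = emeasure lebesgue (\<Union>n. A n)" by (simp add: H_def A_def if_distrib[of "(\<in>) _"])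
  also have "\<dots> \<le> (\<Sum>n. emeasure lebesgue (A n))"
    by (rule emeasure_subadditive_countably) (auto simp: A_def)
  also have "\<dots> \<le> (\<Sum>n. ennreal (\<epsilon> n * (\<rho> ^ 3 * V)))"
    by (intro suminf_le bnd) auto
  also have "\<dots> = ennreal (\<Sum>n. \<epsilon> n * (\<rho> ^ 3 * V))"
  proof (rule suminf_ennreal2)
    show "0 \<le> \<epsilon> n * (\<rho> ^ 3 * V)" for n using less_imp_le[OF eps_pos[of n]] V \<rho> by simp
  qed (intro summable_mult2 summable_eps)
  also have "(\<Sum>n. \<epsilon> n * (\<rho> ^ 3 * V)) = \<rho> ^ 3 * (\<Sum>n. \<epsilon> n) * V"
    using suminf_mult2[OF summable_eps, of "\<rho> ^ 3 * V"] by (simp add: ac_simps)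
  finally have "emeasure lebesgue H \<le> ennreal (\<rho> ^ 3 * (\<Sum>n. \<epsilon> n) * V)" .
  from enn2real_mono[OF this ennreal_less_top]
  have "measure lebesgue H \<le> enn2real (ennreal (\<rho> ^ 3 * (\<Sum>n. \<epsilon> n) * V))" by (simp only: measure_def)
  also have "\<dots> = \<rho> ^ 3 * (\<Sum>n. \<epsilon> n) * V"
  proof (rule enn2real_ennreal)
    have "(\<Sum>n. \<epsilon> n) \<ge> 0" using eps_pos by (intro suminf_nonneg summable_eps less_imp_le)
    then show "0 \<le> \<rho> ^ 3 * (\<Sum>n. \<epsilon> n) * V" using \<rho> V by (intro mult_nonneg_nonneg zero_le_power)
  qed
  finally have "measure lebesgue H \<le> \<rho> ^ 3 * (\<Sum>n. \<epsilon> n) * V" .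
  then show "measure lebesgue H \<le> \<rho> ^ 3 * (\<Sum>n. \<epsilon> n) * measure lebesgue (ball (0 :: real ^ 2) 1)"
    by (simp only: V_def)
qed

lemma outer_circle_essential_boundary:
  assumes x: "x \<in> sphere 0 1"
  shows "x \<in> essential_boundary holed_disc"
proof -
  define S where "S = (\<Sum>n. \<epsilon> n)"
  have S: "S \<ge> 0" unfolding S_def using eps_pos by (intro suminf_nonneg summable_eps less_imp_le)
  show ?thesis
  proof (rule in_essential_boundaryI)
    show "holed_disc \<in> sets lebesgue" using open_holed_disc by (simp add: lborelD)
    \<comment> \<open>\<open>\<rho> \<le> 2\<close> keeps the inner tangent ball in the unit disc, \<open>\<rho> * S \<le> 1 / 8\<close> bounds the area of the holes\<close>
    show "min 1 (1 / (8 * (S + 1))) > 0" using S by simp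
    fix \<rho> :: real assume \<rho>: "0 < \<rho>" "\<rho> < min 1 (1 / (8 * (S + 1)))"
    define H where "H = (\<Union>n\<in>{n. \<epsilon> n < 2 * \<rho>}. cball (c n) (r n))"
    have nx: "norm x = 1" using x by simp
    note T = tangent_balls(1,2)[OF nx zero_less_one \<rho>(1), where a=0, simplified]
      tangent_balls(3,4)[OF nx zero_less_one \<rho>(1), where x=x]
    have inner: "ball (x - (\<rho> / 2) *\<^sub>R x) (\<rho> / 2) \<subseteq> ball 0 1" using T(2) \<rho> by simp
    have "ball (x - (\<rho> / 2) *\<^sub>R x) (\<rho> / 2) - H \<subseteq> holed_disc"
      using inner T(4) hole_near_outer_circle[OF x, of _ _ \<rho>] unfolding H_def holed_disc_def by blast
    moreover have "ball (x + (\<rho> / 2) *\<^sub>R x) (\<rho> / 2) \<inter> holed_disc = {}"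
      using T(1) ball_subset_cball unfolding holed_disc_def by blast
    moreover have "measure lebesgue H \<le> \<rho>\<^sup>2 * measure lebesgue (ball (0 :: real ^ 2) 1) / 8"
    proof -
      have "\<rho> * S \<le> 1 / 8"
      proof -
        have "\<rho> * (8 * (S + 1)) < 1" using \<rho> S by (simp add: pos_less_divide_eq)
        then show ?thesis using \<rho> S by (simp add: algebra_simps)
      qed
      then have "(\<rho> * S) * (\<rho>\<^sup>2 * measure lebesgue (ball (0 :: real ^ 2) 1)) \<le> 1 / 8 * (\<rho>\<^sup>2 * measure lebesgue (ball (0 :: real ^ 2) 1))"
        by (rule mult_right_mono) simp
      moreover have "\<rho> ^ 3 * S * measure lebesgue (ball (0 :: real ^ 2) 1) =
          (\<rho> * S) * (\<rho>\<^sup>2 * measure lebesgue (ball (0 :: real ^ 2) 1))"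
        by (simp only: power2_eq_square power3_eq_cube ac_simps)
      moreover have "measure lebesgue H \<le> \<rho> ^ 3 * S * measure lebesgue (ball (0 :: real ^ 2) 1)"
        unfolding H_def S_def by (rule measure_small_holes(2)) (use \<rho> in simp)
      ultimately show ?thesis by linarith
    qed
    moreover have "H \<in> lmeasurable" using measure_small_holes(1)[of \<rho>] \<rho> unfolding H_def by simp
    ultimately show "\<exists>p q H. ball p (\<rho> / 2) \<subseteq> ball x \<rho> \<and> ball q (\<rho> / 2) \<subseteq> ball x \<rho> \<and>
       ball p (\<rho> / 2) - H \<subseteq> holed_disc \<and> ball q (\<rho> / 2) \<inter> holed_disc = {} \<and>
       H \<in> lmeasurable \<and> measure lebesgue H \<le> \<rho>\<^sup>2 * measure lebesgue (ball (0 :: real ^ 2) 1) / 8"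
      using T(3,4) by (intro exI conjI)
  qed
qed

lemma isolated_from_other_holes:
  assumes x: "x \<in> cball (c m) (r m)"
  shows "\<exists>d>0. ball x d \<subseteq> ball 0 1 - (\<Union>n\<in>- {m}. cball (c n) (r n))"
proof -
  have "x \<in> ball 0 1 - (\<Union>n\<in>- {m}. cball (c n) (r n))"
  proof -
    have "x \<notin> cball (c n) (r n)" if "n \<noteq> m" for n using holes_disjoint[OF that] x by blast
    then show ?thesis using x hole_subset[of m] by blast
  qed
  then show ?thesis using open_ball_minus_holes[of "- {m}"] by (simp add: open_contains_ball)
qed

lemma hole_circle_essential_boundary:
  assumes x: "x \<in> sphere (c m) (r m)"
  shows "x \<in> essential_boundary holed_disc"
proof -
  obtain d where d: "d > 0" "ball x d \<subseteq> ball 0 1 - (\<Union>n\<in>- {m}. cball (c n) (r n))"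
    using isolated_from_other_holes[of x m] x by auto
  define u where "u = (1 / r m) *\<^sub>R (x - c m)"
  have u: "norm u = 1" using x r_pos[of m] by (simp add: u_def dist_norm norm_minus_commute)
  have xu: "c m + r m *\<^sub>R u = x" using r_pos[of m] by (simp add: u_def)
  show ?thesis
  proof (rule in_essential_boundaryI)
    show "holed_disc \<in> sets lebesgue" using open_holed_disc by (simp add: lborelD)
    \<comment> \<open>\<open>\<rho> < d\<close> keeps the other holes away, \<open>\<rho> \<le> 2 * r m\<close> keeps the inner tangent ball in the hole\<close>
    show "min d (r m) > 0" using d r_pos by simp
    fix \<rho> :: real assume \<rho>: "0 < \<rho>" "\<rho> < min d (r m)"
    note T = tangent_balls(1,2)[OF u r_pos[of m] \<rho>(1), where a="c m", unfolded xu]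
      tangent_balls(3,4)[OF u r_pos[of m] \<rho>(1), where x=x]
    have "ball (x + (\<rho> / 2) *\<^sub>R u) (\<rho> / 2) - {} \<subseteq> holed_disc"
    proof
      fix y assume "y \<in> ball (x + (\<rho> / 2) *\<^sub>R u) (\<rho> / 2) - {}"
      then have y: "y \<in> ball (x + (\<rho> / 2) *\<^sub>R u) (\<rho> / 2)" by (rule DiffD1)
      have "ball x \<rho> \<subseteq> ball x d" using \<rho> by (intro subset_ball) simp
      then have yd: "y \<in> ball 0 1 - (\<Union>n\<in>- {m}. cball (c n) (r n))" using y T(3) d(2) by fast
      have "y \<notin> cball (c n) (r n)" for n
      proof (cases "n = m")
        case True
        then show ?thesis using y T(1) by (simp only:) fast
      next
        case False
        then show ?thesis using yd by fast
      qed
      then show "y \<in> holed_disc" using yd unfolding holed_disc_def by fast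
    qed
    moreover have "ball (x - (\<rho> / 2) *\<^sub>R u) (\<rho> / 2) \<inter> holed_disc = {}"
    proof -
      have "ball (x - (\<rho> / 2) *\<^sub>R u) (\<rho> / 2) \<subseteq> cball (c m) (r m)"
        using T(2) \<rho> ball_subset_cball[of "c m" "r m"] by auto
      then show ?thesis unfolding holed_disc_def by fast
    qed
    ultimately show "\<exists>p q H. ball p (\<rho> / 2) \<subseteq> ball x \<rho> \<and> ball q (\<rho> / 2) \<subseteq> ball x \<rho> \<and>
       ball p (\<rho> / 2) - H \<subseteq> holed_disc \<and> ball q (\<rho> / 2) \<inter> holed_disc = {} \<and>
       H \<in> lmeasurable \<and> measure lebesgue H \<le> \<rho>\<^sup>2 * measure lebesgue (ball (0 :: real ^ 2) 1) / 8"
      using T(3,4)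
      by (intro exI[of _ "x + (\<rho> / 2) *\<^sub>R u"] exI[of _ "x - (\<rho> / 2) *\<^sub>R u"] exI[of _ "{}"] conjI) auto
  qed
qed

end

section \<open>Normals along the boundary circles\<close>

text \<open>The interval of radius \<open>h\<close> around \<open>\<tau>\<close> may be cut off by an end point of \<open>{0..2 * pi}\<close>, but the half on
  the side of the midpoint \<open>pi\<close> survives.\<close>
lemma set_integral_circle_arc_ge:
  assumes "0 \<le> \<tau>" "\<tau> < 2 * pi" "0 < h" "h \<le> pi"
  shows "h \<le> (LINT t|lborel. indicator {t. 0 \<le> t \<and> t \<le> 2 * pi \<and> \<bar>t - \<tau>\<bar> < h} t)"
proof -
  define S where "S = {t. 0 \<le> t \<and> t \<le> 2 * pi \<and> \<bar>t - \<tau>\<bar> < h}"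
  define l where "l = (if \<tau> \<le> pi then \<tau> else \<tau> - h)"
  have sub: "{l<..<l + h} \<subseteq> S" using assms by (auto simp: l_def S_def)
  have S: "S = {0..2 * pi} \<inter> {\<tau> - h<..<\<tau> + h}" by (auto simp: S_def)
  have "h = measure lborel {l<..<l + h}" using assms by simp
  also have "\<dots> \<le> measure lborel S"
  proof (rule measure_mono_fmeasurable[OF sub])
    show "S \<in> fmeasurable lborel"
      unfolding S by (rule fmeasurableI2[of "{0..2 * pi}"]) (auto simp: fmeasurable_def)
  qed simp
  finally show ?thesis unfolding S_def[symmetric] by (simp add: S)
qed

context shrinking_holes
begin

definition boundary_mass :: "(real ^ 2) measure" where
  "boundary_mass = mass_pushforward circle_space boundary_point normal_weight"

text \<open>The length inside the ball of all boundary circles except the \<open>m\<close>-th one.\<close>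
definition other_mass :: "nat \<Rightarrow> real ^ 2 \<Rightarrow> real \<Rightarrow> real" where
  "other_mass m x \<rho> =
     (LINT z|circle_space. (if fst z = m then 0 else indicator (ball x \<rho>) (boundary_point z) * norm (normal_weight z)))"

lemma norm_normal_weight: "norm (normal_weight (n, t)) = rad n * indicator {0..2 * pi} t"
  unfolding normal_weight_def using rad_pos[of n] by (intro norm_circle_weight) auto

lemma boundary_point_borel' [measurable]: "(\<lambda>t. boundary_point (n, t)) \<in> borel_measurable borel"
  unfolding boundary_point_def circle_point_def by simp

lemma normal_weight_borel' [measurable]: "(\<lambda>t. normal_weight (n, t)) \<in> borel_measurable borel"
  unfolding normal_weight_def circle_weight_def by simp

lemma integrable_masked_mass:
  assumes B: "B \<in> sets borel"
  shows "integrable circle_space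
    (\<lambda>z. (if fst z \<in> N then indicator B (boundary_point z) * norm (normal_weight z) else 0))"
proof (rule integrable_circle_space[where b=rad])
  show "(\<lambda>t. if fst (n, t) \<in> N then indicator B (boundary_point (n, t)) * norm (normal_weight (n, t)) else 0)
      \<in> borel_measurable borel" for n
    using B by (cases "n \<in> N") auto
  show "norm (if fst (n, t) \<in> N then indicator B (boundary_point (n, t)) * norm (normal_weight (n, t)) else 0)
      \<le> rad n * indicator {0..2 * pi} t" for n t
    using rad_pos[of n] by (auto simp: norm_normal_weight indicator_def)
qed (rule summable_rad)

lemma measure_boundary_mass:
  assumes "B \<in> sets borel"
  shows "measure boundary_mass B = (LINT z|circle_space. indicator B (boundary_point z) * norm (normal_weight z))"
  unfolding boundary_mass_def
  by (rule measure_mass_pushforward[OF boundary_point_borel integrable_normal_weight assms])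

text \<open>Angles within \<open>\<rho> / rad m\<close> of \<open>\<tau>\<close> give points in the ball, because chords are shorter than arcs.\<close>
lemma measure_boundary_mass_ball_ge:
  assumes \<tau>: "0 \<le> \<tau>" "\<tau> < 2 * pi" and x: "x = ctr m + rad m *\<^sub>R circle_dir \<tau>"
    and \<rho>: "0 < \<rho>" "\<rho> \<le> rad m"
  shows "\<rho> \<le> measure boundary_mass (ball x \<rho>)"
proof -
  define h where "h = \<rho> / rad m"
  have "h \<le> 1" using \<rho> rad_pos[of m] by (simp add: h_def)
  then have h: "0 < h" "h \<le> pi"
    using \<rho> rad_pos[of m] pi_ge_two unfolding h_def by (auto simp del: divide_le_eq_1_pos)
  define f where "f z = (if fst z \<in> {m} then indicator (ball x \<rho>) (boundary_point z) * norm (normal_weight z) else 0)" for z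
  have f: "integrable circle_space f" unfolding f_def by (rule integrable_masked_mass) simp
  define S where "S = {t. 0 \<le> t \<and> t \<le> 2 * pi \<and> \<bar>t - \<tau>\<bar> < h}"
  have S: "S = {0..2 * pi} \<inter> {\<tau> - h<..<\<tau> + h}" by (auto simp: S_def)
  have near: "boundary_point (m, t) \<in> ball x \<rho>" if "t \<in> S" for t
  proof -
    have "dist x (boundary_point (m, t)) = rad m * norm (circle_dir \<tau> - circle_dir t)"
      using rad_pos[of m]
      by (simp add: x boundary_point_def circle_point_def dist_norm flip: scaleR_diff_right)
    also have "\<dots> \<le> rad m * \<bar>\<tau> - t\<bar>"
      using rad_pos[of m] norm_circle_dir_diff_le[of \<tau> t] by (intro mult_left_mono) auto
    also have "\<dots> < rad m * h"
      using that rad_pos[of m] by (intro mult_strict_left_mono) (auto simp: S_def abs_minus_commute)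
    also have "\<dots> = \<rho>" using rad_pos[of m] by (simp add: h_def)
    finally show ?thesis by simp
  qed
  have "\<rho> = rad m * h" using rad_pos[of m] by (simp add: h_def)
  also have "\<dots> \<le> rad m * (LINT t|lborel. indicator S t)"
    using set_integral_circle_arc_ge[OF \<tau> h] rad_pos[of m] unfolding S_def by (intro mult_left_mono) auto
  also have "\<dots> = (LINT t|lborel. rad m * indicator S t)" by simp
  also have "\<dots> \<le> (LINT t|lborel. f (m, t))"
  proof (rule integral_mono)
    have "S \<in> fmeasurable lborel" unfolding S by (rule fmeasurableI2[of "{0..2 * pi}"]) (auto simp: fmeasurable_def)
    then show "integrable lborel (\<lambda>t. rad m * indicator S t)"
      by (intro integrable_mult_right integrable_real_indicator) (auto simp: fmeasurable_def)
    have b: "integrable lborel (\<lambda>t. rad m * indicator {0..2 * pi} t :: real)" by simp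
    show "integrable lborel (\<lambda>t. f (m, t))"
      by (rule Bochner_Integration.integrable_bound[OF b])
        (use rad_pos[of m] in \<open>auto simp: f_def norm_normal_weight indicator_def\<close>)
    show "rad m * indicator S t \<le> f (m, t)" for t
      using near[of t] rad_pos[of m] by (auto simp: f_def norm_normal_weight indicator_def S_def)
  qed
  also have "\<dots> = (LINT z|circle_space. f z)"
  proof -
    have "(\<lambda>n. LINT t|lborel. f (n, t)) sums (LINT t|lborel. f (m, t))"
      using sums_single[of m "\<lambda>n. LINT t|lborel. f (n, t)"]
      by (rule sums_cong[THEN iffD1, rotated]) (simp add: f_def)
    then show ?thesis using sums_circle_space[OF f] by (rule sums_unique2)
  qed
  also have "\<dots> \<le> measure boundary_mass (ball x \<rho>)"
    unfolding measure_boundary_mass[OF borel_open[OF open_ball]]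
  proof (rule integral_mono[OF f])
    show "integrable circle_space (\<lambda>z. indicator (ball x \<rho>) (boundary_point z) * norm (normal_weight z))"
      using integrable_masked_mass[of "ball x \<rho>" UNIV] by simp
  qed (simp add: f_def)
  finally show ?thesis .
qed

text \<open>Along the part of the \<open>m\<close>-th circle inside the ball the normal differs from the normal at \<open>x\<close> by at
  most \<open>\<rho> / rad m\<close>; for all other circles the trivial bound 2 is used.\<close>
lemma normal_measure_ball_close:
  assumes x: "x = ctr m + rad m *\<^sub>R circle_dir \<tau>" and \<rho>: "0 < \<rho>"
  shows "norm (normal_measure (ball x \<rho>) - measure boundary_mass (ball x \<rho>) *\<^sub>R (side m *\<^sub>R circle_dir \<tau>))
    \<le> \<rho> / rad m * measure boundary_mass (ball x \<rho>) + 2 * other_mass m x \<rho>"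
proof -
  define \<nu> where "\<nu> = side m *\<^sub>R circle_dir \<tau>"
  define b where "b z = indicator (ball x \<rho>) (boundary_point z) * norm (normal_weight z)" for z
  define b' where "b' z = (if fst z = m then 0 else b z)" for z
  have b: "integrable circle_space b"
    unfolding b_def using integrable_masked_mass[of "ball x \<rho>" UNIV] by simp
  have b': "integrable circle_space b'"
    using integrable_masked_mass[of "ball x \<rho>" "- {m}"]
    unfolding b'_def b_def by (rule Bochner_Integration.integrable_cong[THEN iffD1, rotated 2]) auto
  have D: "integrable circle_space (\<lambda>z. indicator (ball x \<rho>) (boundary_point z) *\<^sub>R normal_weight z)"
    by (rule integrable_indicator_comp[OF boundary_point_borel _ integrable_normal_weight]) simp
  have "normal_measure (ball x \<rho>) - measure boundary_mass (ball x \<rho>) *\<^sub>R \<nu> =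
      (LINT z|circle_space. indicator (ball x \<rho>) (boundary_point z) *\<^sub>R normal_weight z - b z *\<^sub>R \<nu>)"
  proof -
    have "(LINT z|circle_space. b z *\<^sub>R \<nu>) = measure boundary_mass (ball x \<rho>) *\<^sub>R \<nu>"
      using b by (simp add: measure_boundary_mass b_def[abs_def])
    then show ?thesis
      using Bochner_Integration.integral_diff[OF D integrable_scaleR_left[OF b, of \<nu>]]
      by (simp add: normal_measure_def vector_pushforward_def)
  qed
  then have "norm (normal_measure (ball x \<rho>) - measure boundary_mass (ball x \<rho>) *\<^sub>R \<nu>) \<le>
      (LINT z|circle_space. norm (indicator (ball x \<rho>) (boundary_point z) *\<^sub>R normal_weight z - b z *\<^sub>R \<nu>))"
    by simp
  also have "\<dots> \<le> (LINT z|circle_space. \<rho> / rad m * b z + 2 * b' z)"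
  proof (rule integral_mono)
    fix z :: "nat \<times> real"
    obtain n t where z: "z = (n, t)" by (cases z)
    show "norm (indicator (ball x \<rho>) (boundary_point z) *\<^sub>R normal_weight z - b z *\<^sub>R \<nu>) \<le> \<rho> / rad m * b z + 2 * b' z"
    proof (cases "boundary_point z \<in> ball x \<rho>")
      case False
      then show ?thesis by (simp add: b_def b'_def)
    next
      case inside: True
      then have bz: "b z = norm (normal_weight z)" by (simp add: b_def)
      show ?thesis
      proof (cases "n = m")
        case True
        have "rad m * norm (circle_dir \<tau> - circle_dir t) = dist x (boundary_point z)"
          using rad_pos[of m]
          by (simp add: x z True boundary_point_def circle_point_def dist_norm flip: scaleR_diff_right)
        then have close: "norm (circle_dir t - circle_dir \<tau>) \<le> \<rho> / rad m"
          using inside rad_pos[of m] by (simp add: pos_le_divide_eq mult.commute norm_minus_commute)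
        have "normal_weight z - b z *\<^sub>R \<nu> = (b z * side m) *\<^sub>R (circle_dir t - circle_dir \<tau>)"
          unfolding bz unfolding z norm_normal_weight
          by (simp add: True \<nu>_def normal_weight_def circle_weight_def algebra_simps)
        then have "norm (normal_weight z - b z *\<^sub>R \<nu>) = b z * norm (circle_dir t - circle_dir \<tau>)"
          by (simp add: bz abs_mult)
        also have "\<dots> \<le> b z * (\<rho> / rad m)"
          using close by (intro mult_left_mono) (auto simp: bz)
        finally show ?thesis using inside by (simp add: b'_def z True mult.commute)
      next
        case False
        have "norm \<nu> = 1" by (simp add: \<nu>_def)
        then have "norm (normal_weight z - b z *\<^sub>R \<nu>) \<le> 2 * b z"
          using norm_triangle_ineq4[of "normal_weight z" "b z *\<^sub>R \<nu>"] by (simp add: bz)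
        moreover have "\<rho> / rad m * b z \<ge> 0" using \<rho> rad_pos[of m] by (simp add: bz)
        ultimately show ?thesis using inside False by (simp add: b'_def z)
      qed
    qed
  qed (use b b' D in simp_all)
  also have "\<dots> = \<rho> / rad m * measure boundary_mass (ball x \<rho>) + 2 * other_mass m x \<rho>"
  proof -
    have "measure boundary_mass (ball x \<rho>) = (LINT z|circle_space. b z)"
      by (simp add: measure_boundary_mass b_def[abs_def])
    moreover have "other_mass m x \<rho> = (LINT z|circle_space. b' z)"
      unfolding other_mass_def b'_def b_def ..
    ultimately show ?thesis using b b' by simp
  qed
  finally show ?thesis unfolding \<nu>_def .
qed

text \<open>The circle through \<open>x\<close> contributes a length of at least \<open>\<rho>\<close>, so other circles of total length
  \<open>O(\<rho>\<^sup>2)\<close> do not affect the limit of the averaged normal.\<close>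
lemma in_reduced_boundary_of_other_mass:
  assumes \<tau>: "0 \<le> \<tau>" "\<tau> < 2 * pi" and x: "x = ctr m + rad m *\<^sub>R circle_dir \<tau>"
    and ess: "x \<in> essential_boundary holed_disc"
    and \<delta>: "\<delta> > 0" and other: "\<And>\<rho>. 0 < \<rho> \<Longrightarrow> \<rho> < \<delta> \<Longrightarrow> other_mass m x \<rho> \<le> K * \<rho>\<^sup>2"
  shows "x \<in> reduced_boundary holed_disc"
proof (rule in_reduced_boundaryI[OF boundary_point_borel integrable_normal_weight])
  show "is_gradient_measure holed_disc (vector_pushforward circle_space boundary_point normal_weight)"
    using is_gradient_normal_measure by (simp add: normal_measure_def)
  define \<nu> where "\<nu> = side m *\<^sub>R circle_dir \<tau>"
  show "norm (side m *\<^sub>R circle_dir \<tau>) = 1" by simp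
  define Q where "Q \<rho> = normal_measure (ball x \<rho>) /\<^sub>R measure boundary_mass (ball x \<rho>)" for \<rho>
  have close: "norm (Q \<rho> - \<nu>) \<le> \<rho> * (1 / rad m + 2 * K)" if \<rho>: "0 < \<rho>" "\<rho> < min \<delta> (rad m)" for \<rho>
  proof -
    define \<mu> where "\<mu> = measure boundary_mass (ball x \<rho>)"
    have \<mu>: "\<rho> \<le> \<mu>" unfolding \<mu>_def using \<rho> by (intro measure_boundary_mass_ball_ge[OF \<tau> x]) auto
    have "other_mass m x \<rho> \<ge> 0"
      unfolding other_mass_def by (rule integral_nonneg_AE) auto
    then have K: "K * \<rho>\<^sup>2 \<ge> 0" using other[of \<rho>] \<rho> by simp
    have "\<mu> *\<^sub>R (Q \<rho> - \<nu>) = normal_measure (ball x \<rho>) - \<mu> *\<^sub>R \<nu>"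
      using \<mu> \<rho> by (simp add: Q_def scaleR_diff_right flip: \<mu>_def)
    then have "\<mu> * norm (Q \<rho> - \<nu>) = norm (normal_measure (ball x \<rho>) - \<mu> *\<^sub>R \<nu>)"
    proof -
      have "norm (\<mu> *\<^sub>R (Q \<rho> - \<nu>)) = \<mu> * norm (Q \<rho> - \<nu>)" using \<mu> \<rho> by simp
      then show ?thesis using \<open>\<mu> *\<^sub>R (Q \<rho> - \<nu>) = _\<close> by simp
    qed
    also have "\<dots> \<le> \<rho> / rad m * \<mu> + 2 * other_mass m x \<rho>"
      using normal_measure_ball_close[OF x \<rho>(1)] by (simp add: \<mu>_def \<nu>_def)
    also have "\<dots> \<le> \<rho> / rad m * \<mu> + 2 * (K * \<rho>\<^sup>2)" using other[of \<rho>] \<rho> by simp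
    also have "\<dots> \<le> \<rho> / rad m * \<mu> + 2 * (K * \<rho> * \<mu>)"
    proof -
      have "K \<ge> 0" using K \<rho> by (auto simp: zero_le_mult_iff)
      then have "K * \<rho> \<ge> 0" using \<rho> by simp
      then have "K * \<rho> * \<rho> \<le> K * \<rho> * \<mu>" using \<mu> by (rule mult_left_mono[rotated])
      then show ?thesis by (simp add: power2_eq_square mult.assoc)
    qed
    also have "\<dots> = \<mu> * (\<rho> * (1 / rad m + 2 * K))" by (simp add: algebra_simps)
    finally show ?thesis using \<mu> \<rho> by simp
  qed
  have "((\<lambda>\<rho>. Q \<rho> - \<nu>) \<longlongrightarrow> 0) (at_right 0)"
  proof (rule Lim_null_comparison)
    show "\<forall>\<^sub>F \<rho> in at_right 0. norm (Q \<rho> - \<nu>) \<le> \<rho> * (1 / rad m + 2 * K)"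
      unfolding eventually_at_right_field using close \<delta> rad_pos[of m]
      by (intro exI[of _ "min \<delta> (rad m)"]) auto
    have "((\<lambda>\<rho>. \<rho> * (1 / rad m + 2 * K)) \<longlongrightarrow> 0 * (1 / rad m + 2 * K)) (at_right 0)"
      by (intro tendsto_intros)
    then show "((\<lambda>\<rho>. \<rho> * (1 / rad m + 2 * K)) \<longlongrightarrow> 0) (at_right 0)" by simp
  qed
  then have "(Q \<longlongrightarrow> \<nu>) (at_right 0)" by (simp add: Lim_null[symmetric])
  then show "((\<lambda>\<rho>. vector_pushforward circle_space boundary_point normal_weight (ball x \<rho>) /\<^sub>R
      measure (mass_pushforward circle_space boundary_point normal_weight) (ball x \<rho>)) \<longlongrightarrow>
      side m *\<^sub>R circle_dir \<tau>) (at_right 0)"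
    by (simp add: Q_def[abs_def] \<nu>_def normal_measure_def boundary_mass_def)
qed (rule ess)

lemma boundary_point_in_hole: "boundary_point (Suc n, t) \<in> cball (c n) (r n)"
  using r_pos[of n] by (simp add: boundary_point_def circle_point_def dist_norm)

text \<open>Pointwise on the parameter space, the weight of a hole that meets the ball is at most \<open>\<rho>\<^sup>2\<close> times its
  depth, and the depths are summable.\<close>
lemma other_mass_outer_circle:
  assumes x: "x \<in> sphere 0 1"
  shows "\<exists>K. \<forall>\<rho>>0. other_mass 0 x \<rho> \<le> K * \<rho>\<^sup>2"
proof -
  define e where "e n = (case n of 0 \<Rightarrow> 0 | Suc k \<Rightarrow> \<epsilon> k)" for n
  define b where "b z = e (fst z) * indicator {0..2 * pi} (snd z)" for z :: "nat \<times> real"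
  have e: "e n \<ge> 0" "e (Suc n) = \<epsilon> n" for n using eps_pos by (auto simp: e_def less_imp_le split: nat.split)
  have "summable e" using summable_Suc_iff[of e] summable_eps by (simp add: e)
  then have b: "integrable circle_space b"
    by (intro integrable_circle_space[where b=e]) (use e in \<open>auto simp: b_def indicator_def\<close>)
  have "other_mass 0 x \<rho> \<le> (LINT z|circle_space. b z) * \<rho>\<^sup>2" if \<rho>: "\<rho> > 0" for \<rho>
  proof -
    have "other_mass 0 x \<rho> \<le> (LINT z|circle_space. b z * \<rho>\<^sup>2)"
      unfolding other_mass_def
    proof (rule integral_mono)
      show "integrable circle_space
          (\<lambda>z. if fst z = 0 then 0 else indicator (ball x \<rho>) (boundary_point z) * norm (normal_weight z))"
        using integrable_masked_mass[of "ball x \<rho>" "- {0}"]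
        by (rule Bochner_Integration.integrable_cong[THEN iffD1, rotated 2]) auto
      show "integrable circle_space (\<lambda>z. b z * \<rho>\<^sup>2)" using b by simp
      fix z :: "nat \<times> real"
      obtain n t where z: "z = (n, t)" by (cases z)
      show "(if fst z = 0 then 0 else indicator (ball x \<rho>) (boundary_point z) * norm (normal_weight z)) \<le> b z * \<rho>\<^sup>2"
      proof (cases n)
        case 0
        then show ?thesis by (simp add: z b_def e_def)
      next
        case (Suc k)
        have "r k \<le> \<epsilon> k * \<rho>\<^sup>2" if "boundary_point z \<in> ball x \<rho>"
          using r_le_of_eps_less[OF hole_near_outer_circle[OF x boundary_point_in_hole]] that by (simp add: z Suc)
        then show ?thesis
          using eps_pos[of k] by (auto simp: z Suc b_def e norm_normal_weight indicator_def)
      qed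
    qed
    then show ?thesis by simp
  qed
  then show ?thesis by blast
qed

lemma other_mass_hole_circle:
  assumes x: "x \<in> sphere (c m) (r m)"
  shows "\<exists>\<delta>>0. \<forall>\<rho><\<delta>. other_mass (Suc m) x \<rho> = 0"
proof -
  obtain d where d: "d > 0" "ball x d \<subseteq> ball 0 1 - (\<Union>n\<in>- {m}. cball (c n) (r n))"
    using isolated_from_other_holes[of x m] x by auto
  have far: "boundary_point (n, t) \<notin> ball x d" if "n \<noteq> Suc m" for n t
  proof (cases n)
    case 0
    then have "boundary_point (n, t) \<notin> ball 0 1" by (simp add: boundary_point_def circle_point_def)
    then show ?thesis using d(2) by blast
  next
    case (Suc k)
    then have "k \<in> - {m}" using that by simp
    then show ?thesis using d(2) boundary_point_in_hole[of k t] unfolding Suc by blast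
  qed
  have "other_mass (Suc m) x \<rho> = 0" if "\<rho> < d" for \<rho>
  proof -
    have "boundary_point z \<notin> ball x \<rho>" if "fst z \<noteq> Suc m" for z
      using far[OF that, of "snd z"] subset_ball[of \<rho> d x] \<open>\<rho> < d\<close> by auto
    then have "(\<lambda>z. if fst z = Suc m then 0 else indicator (ball x \<rho>) (boundary_point z) * norm (normal_weight z)) =
        (\<lambda>z. 0 :: real)"
      by (simp add: fun_eq_iff)
    then show ?thesis unfolding other_mass_def by simp
  qed
  then show ?thesis using d(1) by blast
qed

lemma outer_circle_reduced_boundary:
  assumes x: "x \<in> sphere 0 1"
  shows "x \<in> reduced_boundary holed_disc"
proof -
  obtain \<tau> where \<tau>: "0 \<le> \<tau>" "\<tau> < 2 * pi" "x = 0 + 1 *\<^sub>R circle_dir \<tau>"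
    using sphere_eq_circle_dir[OF x zero_less_one] by blast
  obtain K where K: "\<forall>\<rho>>0. other_mass 0 x \<rho> \<le> K * \<rho>\<^sup>2" using other_mass_outer_circle[OF x] by blast
  have "x = ctr 0 + rad 0 *\<^sub>R circle_dir \<tau>" using \<tau>(3) by simp
  from in_reduced_boundary_of_other_mass[OF \<tau>(1,2) this outer_circle_essential_boundary[OF x] zero_less_one] K
  show ?thesis by blast
qed

lemma hole_circle_reduced_boundary:
  assumes x: "x \<in> sphere (c m) (r m)"
  shows "x \<in> reduced_boundary holed_disc"
proof -
  obtain \<tau> where \<tau>: "0 \<le> \<tau>" "\<tau> < 2 * pi" "x = c m + r m *\<^sub>R circle_dir \<tau>"
    using sphere_eq_circle_dir[OF x r_pos] by blast
  obtain \<delta> where \<delta>: "\<delta> > 0" "\<forall>\<rho><\<delta>. other_mass (Suc m) x \<rho> = 0" using other_mass_hole_circle[OF x] by blast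
  have "x = ctr (Suc m) + rad (Suc m) *\<^sub>R circle_dir \<tau>" using \<tau>(3) by simp
  from in_reduced_boundary_of_other_mass[OF \<tau>(1,2) this hole_circle_essential_boundary[OF x] \<delta>(1), of 0] \<delta>(2)
  show ?thesis by simp
qed

lemma frontier_holed_disc_subset: "frontier holed_disc \<subseteq> sphere 0 1 \<union> (\<Union>n. sphere (c n) (r n))"
proof
  fix x assume x: "x \<in> frontier holed_disc"
  have cl: "x \<in> closure holed_disc" and nin: "x \<notin> holed_disc"
    using x open_holed_disc by (auto simp: frontier_def interior_open)
  have "closure holed_disc \<subseteq> cball 0 1"
    by (rule closure_minimal) (auto simp: holed_disc_def)
  then have "x \<in> cball 0 1" using cl by blast
  then consider "x \<in> sphere 0 1" | "x \<in> ball 0 1" by (auto simp: le_less)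
  then show "x \<in> sphere 0 1 \<union> (\<Union>n. sphere (c n) (r n))"
  proof cases
    case 2
    then obtain n where n: "x \<in> cball (c n) (r n)" using nin by (auto simp: holed_disc_def)
    have "ball (c n) (r n) \<inter> closure holed_disc = {}"
    proof -
      have "ball (c n) (r n) \<inter> holed_disc = {}"
        using ball_subset_cball[of "c n" "r n"] unfolding holed_disc_def by fast
      then show ?thesis by (simp add: open_Int_closure_eq_empty)
    qed
    then have "x \<notin> ball (c n) (r n)" using cl by blast
    then have "x \<in> sphere (c n) (r n)" using n by simp
    then show ?thesis by blast
  qed blast
qed

text \<open>The frontier is contained in the union of the circles, every circle in the reduced boundary, and the
  reduced boundary in the essential boundary, which is contained in the frontier.\<close>
theorem frontier_eq_reduced_boundary: "frontier holed_disc = reduced_boundary holed_disc"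
proof
  show "frontier holed_disc \<subseteq> reduced_boundary holed_disc"
    using frontier_holed_disc_subset outer_circle_reduced_boundary hole_circle_reduced_boundary by blast
  show "reduced_boundary holed_disc \<subseteq> frontier holed_disc"
    using essential_boundary_subset_frontier[of holed_disc] by (auto simp: reduced_boundary_def)
qed

end

section \<open>Enumeration of the holes\<close>

definition index_seq :: "nat \<Rightarrow> nat \<times> nat" where
  "index_seq n = (next_index ^^ n) (1, 1)"

lemma index_seq_simps [simp]: "index_seq 0 = (1, 1)" "index_seq (Suc n) = next_index (index_seq n)"
  by (simp_all add: index_seq_def)

lemma index_seq_in_hole_index: "index_seq n \<in> hole_index"
proof (induction n)
  case 0
  show ?case by (simp add: hole_index_def)
next
  case (Suc n)
  then show ?case by (auto simp: hole_index_def next_index_def split: prod.splits)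
qed

text \<open>Each row starts one step after the end of the preceding row, so iterating the successor reaches every
  row and then every entry of it.\<close>
lemma range_index_seq: "range index_seq = hole_index"
proof
  show "range index_seq \<subseteq> hole_index" using index_seq_in_hole_index by blast
  have row: "(j1, Suc k) \<in> range index_seq" if "(j1, 1) \<in> range index_seq" "Suc k \<le> j1" for j1 k
    using that
  proof (induction k)
    case (Suc k)
    then obtain n where "index_seq n = (j1, Suc k)" by (auto simp: image_iff)
    then have "index_seq (Suc n) = (j1, Suc (Suc k))" using Suc.prems by (simp add: next_index_def)
    then show ?case by (metis rangeI)
  qed simp
  have start: "(Suc k, 1) \<in> range index_seq" for k
  proof (induction k)
    case 0
    have "index_seq 0 = (Suc 0, 1)" by simp
    then show ?case by (metis rangeI)
  next
    case (Suc k)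
    from row[OF Suc, of k] obtain n where "index_seq n = (Suc k, Suc k)" by (auto simp: image_iff)
    then have "index_seq (Suc n) = (Suc (Suc k), 1)" by (simp add: next_index_def)
    then show ?case by (metis rangeI)
  qed
  show "hole_index \<subseteq> range index_seq"
  proof clarify
    fix j1 j2 assume "(j1, j2) \<in> hole_index"
    then obtain k l where "j2 = Suc k" "j1 = Suc l" "Suc k \<le> j1"
      by (cases j2; cases j1) (auto simp: hole_index_def)
    then show "(j1, j2) \<in> range index_seq" using row[OF start, of k l] by simp
  qed
qed

theorem proposition3p1:
  fixes \<epsilon> r :: "nat \<times> nat \<Rightarrow> real"
  assumes "\<And>j. j \<in> hole_index \<Longrightarrow> 0 < \<epsilon> j \<and> \<epsilon> j < 1 / 2"
    and "\<And>j. j \<in> hole_index \<Longrightarrow> 0 < r j \<and> r j < 1 / 2"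
    and "r summable_on hole_index"
    and "infsum r hole_index \<le> 1 / (2 ^ 8 + 1)"
    and "\<epsilon> (1, 1) < 1 / 4"
    and "\<And>j. j \<in> hole_index \<Longrightarrow> \<epsilon> (next_index j) \<le> 3 / 10 * \<epsilon> j"
    and "\<And>j. j \<in> hole_index \<Longrightarrow> r j \<le> \<epsilon> j ^ 3 / 2 ^ 18"
  shows "finite_perimeter (perforated_disk \<epsilon> r) \<and>
         frontier (perforated_disk \<epsilon> r) = reduced_boundary (perforated_disk \<epsilon> r)"
proof -
  define c where "c n = hole_center \<epsilon> (index_seq n)" for n
  interpret shrinking_holes c "\<lambda>n. \<epsilon> (index_seq n)" "\<lambda>n. r (index_seq n)"
  proof
    fix n
    note idx = index_seq_in_hole_index[of n]
    show "0 < \<epsilon> (index_seq n)" "\<epsilon> (index_seq n) < 1 / 2" "0 < r (index_seq n)"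
      using assms(1,2)[OF idx] by auto
    then show "norm (c n) = 1 - \<epsilon> (index_seq n)"
      by (simp add: c_def hole_center_def vector_eq_plane_point flip: circle_dir_def)
    show "\<epsilon> (index_seq (Suc n)) \<le> 3 / 10 * \<epsilon> (index_seq n)" using assms(6)[OF idx] by simp
    show "r (index_seq n) \<le> \<epsilon> (index_seq n) ^ 3 / 2 ^ 18" by (rule assms(7)[OF idx])
  qed
  have "closure (hole \<epsilon> r (index_seq n)) = cball (c n) (r (index_seq n))" for n
    using r_pos[of n] by (simp add: hole_def c_def)
  then have "perforated_disk \<epsilon> r = holed_disc"
    unfolding perforated_disk_def holed_disc_def range_index_seq[symmetric] by simp
  then show ?thesis using finite_perimeter_holed_disc frontier_eq_reduced_boundary by simp
qed

end
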